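(* Let $n\geq1$. The subgroup $I_n=\mathrm{Inn}(F_n)\,P\Sigma_n^+$ of $IA_n$ satisfies the Andreadakis equality.
   Context: $F_n$ is the free group with a fixed ordered basis $(x_1,\dots,x_n)$; $IA_n$ is the group of automorphisms of $F_n$ acting trivially on $F_n^{ab}$; $\mathrm{Inn}(F_n)$ is the group of inner automorphisms. Write $x^w=w^{-1}xw$. $P\Sigma_n^+$ (the triangular McCool group) is the group of triangular basis-conjugating automorphisms of $F_n$, i.e. the automorphisms of the form $x_i\mapsto x_i^{w_i}$ for all $i$, with $w_i\in\langle x_j\rangle_{j<i}$. The product $I_n=\mathrm{Inn}(F_n)P\Sigma_n^+$ is called the partial inner automorphism group. The lower central series of a group $K$ is $\Gamma_1(K)=K$, $\Gamma_{j+1}(K)=[K,\Gamma_j(K)]$. The Andreadakis filtration on $IA_n$ is $\mathcal{A}_j=\{\varphi\in\mathrm{Aut}(F_n) : \forall i\geq1,\ \forall g\in\Gamma_i(F_n),\ \varphi(g)g^{-1}\in\Gamma_{i+j}(F_n)\}$. A subgroup $K\subseteq IA_n$ satisfies the Andreadakis equality if the inclusions $\Gamma_j(K)\subseteq K\cap\Gamma_j(IA_n)\subseteq K\cap\mathcal{A}_j$ are equalities for all $j\geq1$. *)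

theory Defs
  imports "HOL-Algebra.Algebra"
begin

section \<open>The free group \<open>F\<^sub>n\<close>\<close>

text \<open>
  The letter \<open>(i, True)\<close> stands for \<open>x\<^sub>i\<close> and \<open>(i, False)\<close> for its inverse. The elements of \<open>F\<^sub>n\<close>
  are the reduced words in the letters with \<open>1 \<le> i \<le> n\<close>; the product concatenates and cancels.
\<close>

type_synonym letter = "nat \<times> bool"

definition letter_inv :: "letter \<Rightarrow> letter" where
  "letter_inv a = (fst a, \<not> snd a)"

definition reduced :: "letter list \<Rightarrow> bool" where
  "reduced w \<longleftrightarrow> successively (\<lambda>a b. b \<noteq> letter_inv a) w"

fun push :: "letter \<Rightarrow> letter list \<Rightarrow> letter list" where
  "push a [] = [a]"
| "push a (b # w) = (if b = letter_inv a then w else a # b # w)"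

definition free_group :: "nat \<Rightarrow> letter list monoid" where
  "free_group n =
     \<lparr>carrier = {w. set w \<subseteq> {1..n} \<times> UNIV \<and> reduced w},
      monoid.mult = (\<lambda>u v. foldr push u v),
      one = []\<rparr>"

definition gen :: "nat \<Rightarrow> letter list" where
  "gen i = [(i, True)]"

lemma letter_inv_inv [simp]: "letter_inv (letter_inv a) = a"
  by (simp add: letter_inv_def)

lemma fst_letter_inv [simp]: "fst (letter_inv a) = fst a"
  by (simp add: letter_inv_def)

lemma reduced_push: "reduced w \<Longrightarrow> reduced (push a w)"
  by (cases w) (auto simp: reduced_def successively_Cons)

lemma push_push_inv: "reduced w \<Longrightarrow> push a (push (letter_inv a) w) = w"
  by (cases w rule: remdups_adj.cases) (auto simp: reduced_def successively_Cons)

lemma push_inv_push: "reduced w \<Longrightarrow> push (letter_inv a) (push a w) = w"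
  using push_push_inv[of w "letter_inv a"] by simp

lemma reduced_foldr: "reduced v \<Longrightarrow> reduced (foldr push u v)"
  by (induction u) (auto simp: reduced_push)

lemma set_push: "set (push a w) \<subseteq> insert a (set w)"
  by (cases w) auto

lemma set_foldr: "set (foldr push u v) \<subseteq> set u \<union> set v"
  using set_push by (induction u) fastforce+

lemma foldr_push_push: "reduced w \<Longrightarrow> foldr push (push a v) w = push a (foldr push v w)"
  by (cases v) (auto simp: push_push_inv reduced_foldr)

lemma foldr_push_assoc:
  "reduced w \<Longrightarrow> foldr push (foldr push u v) w = foldr push u (foldr push v w)"
  by (induction u) (auto simp: foldr_push_push)

lemma foldr_push_Nil: "reduced w \<Longrightarrow> foldr push w [] = w"
proof (induction w)
  case (Cons a w)
  then show ?case by (cases w) (auto simp: reduced_def)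
qed simp

lemma foldr_push_inv:
  "reduced v \<Longrightarrow> foldr push (rev (map letter_inv u)) (foldr push u v) = v"
  by (induction u arbitrary: v) (auto simp: push_inv_push reduced_foldr)

lemma group_free_group: "group (free_group n)"
proof (rule groupI)
  fix u v assume "u \<in> carrier (free_group n)" "v \<in> carrier (free_group n)"
  then show "u \<otimes>\<^bsub>free_group n\<^esub> v \<in> carrier (free_group n)"
    using set_foldr[of u v] by (auto simp: free_group_def reduced_foldr)
next
  show "\<one>\<^bsub>free_group n\<^esub> \<in> carrier (free_group n)"
    by (simp add: free_group_def reduced_def)
next
  fix u assume u: "u \<in> carrier (free_group n)"
  then have ru: "reduced u" by (simp add: free_group_def)
  define v where "v = foldr push (rev (map letter_inv u)) []"
  have "set v \<subseteq> set (rev (map letter_inv u))"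
    using set_foldr[of "rev (map letter_inv u)" "[]"] by (simp add: v_def)
  moreover have "set (rev (map letter_inv u)) \<subseteq> {1..n} \<times> UNIV"
    using u by (auto simp: free_group_def letter_inv_def)
  moreover have "reduced v"
    unfolding v_def by (rule reduced_foldr) (simp add: reduced_def)
  ultimately have "v \<in> carrier (free_group n)"
    by (auto simp: free_group_def)
  moreover have "foldr push v u = []"
    using foldr_push_inv[of "[]" u] foldr_push_assoc[OF ru, of "rev (map letter_inv u)" "[]"]
      foldr_push_Nil[OF ru]
    by (simp add: v_def reduced_def)
  ultimately show "\<exists>v\<in>carrier (free_group n). v \<otimes>\<^bsub>free_group n\<^esub> u = \<one>\<^bsub>free_group n\<^esub>"
    by (auto simp: free_group_def)
qed (auto simp: free_group_def foldr_push_assoc)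

lemma gen_in_carrier: "i \<in> {1..n} \<Longrightarrow> gen i \<in> carrier (free_group n)"
  by (simp add: gen_def free_group_def reduced_def)

lemma inv_gen: "i \<in> {1..n} \<Longrightarrow> inv\<^bsub>free_group n\<^esub> (gen i) = [(i, False)]"
  by (rule group.inv_equality[OF group_free_group])
    (auto simp: gen_def free_group_def reduced_def letter_inv_def)

text \<open>The universal property: \<open>gen 1, \<dots>, gen n\<close> is a free basis.\<close>

theorem free_group_universal:
  assumes "group G" and g: "\<And>i. i \<in> {1..n} \<Longrightarrow> g i \<in> carrier G"
  shows "\<exists>!h. h \<in> hom (free_group n) G \<inter> extensional (carrier (free_group n)) \<and>
              (\<forall>i\<in>{1..n}. h (gen i) = g i)"
proof -
  interpret G: group G by fact
  interpret F: group "free_group n" by (rule group_free_group)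
  define lv where "lv = (\<lambda>a. if snd a then g (fst a) else inv\<^bsub>G\<^esub> (g (fst a)))"
  define ev where "ev = (\<lambda>w. foldr (\<lambda>a y. lv a \<otimes>\<^bsub>G\<^esub> y) w \<one>\<^bsub>G\<^esub>)"
  let ?L = "{1..n} \<times> (UNIV :: bool set)"
  have lv: "lv a \<in> carrier G" if "a \<in> ?L" for a
    using that g by (auto simp: lv_def)
  have ev: "ev w \<in> carrier G" if "set w \<subseteq> ?L" for w
    using that lv by (induction w) (auto simp: ev_def)
  have lv_inv: "lv a \<otimes>\<^bsub>G\<^esub> lv (letter_inv a) = \<one>\<^bsub>G\<^esub>" if "a \<in> ?L" for a
    using that g by (auto simp: lv_def letter_inv_def)
  have ev_Cons: "ev (a # w) = lv a \<otimes>\<^bsub>G\<^esub> ev w" for a w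
    by (simp add: ev_def)
  have push: "ev (push a w) = lv a \<otimes>\<^bsub>G\<^esub> ev w" if "a \<in> ?L" "set w \<subseteq> ?L" for a w
  proof (cases w)
    case Nil
    then show ?thesis by (simp add: ev_def)
  next
    case (Cons b v)
    have "lv a \<otimes>\<^bsub>G\<^esub> (lv (letter_inv a) \<otimes>\<^bsub>G\<^esub> ev v) = ev v" if "b = letter_inv a"
      using that Cons \<open>a \<in> ?L\<close> \<open>set w \<subseteq> ?L\<close> lv[of a] lv[of b] ev[of v] lv_inv[of a]
      by (simp add: G.m_assoc[symmetric])
    then show ?thesis using Cons by (auto simp: ev_Cons)
  qed
  have mult: "ev (foldr push u v) = ev u \<otimes>\<^bsub>G\<^esub> ev v" if "set u \<subseteq> ?L" "set v \<subseteq> ?L" for u v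
    using that
  proof (induction u)
    case Nil
    then show ?case using ev[of v] by (simp add: ev_def)
  next
    case (Cons a u)
    then have "set (foldr push u v) \<subseteq> ?L" using set_foldr[of u v] by auto
    then show ?case
      using Cons lv[of a] ev[of u] ev[of v] by (simp add: push ev_Cons G.m_assoc)
  qed
  show ?thesis
  proof (rule ex1I)
    let ?h = "restrict ev (carrier (free_group n))"
    have "?h \<in> hom (free_group n) G"
    proof (rule homI)
      fix u v assume uv: "u \<in> carrier (free_group n)" "v \<in> carrier (free_group n)"
      then have "u \<otimes>\<^bsub>free_group n\<^esub> v \<in> carrier (free_group n)" by simp
      with uv show "?h (u \<otimes>\<^bsub>free_group n\<^esub> v) = ?h u \<otimes>\<^bsub>G\<^esub> ?h v"
        using mult[of u v] by (simp add: free_group_def)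
    next
      fix u assume "u \<in> carrier (free_group n)"
      then show "?h u \<in> carrier G" using ev[of u] by (simp add: free_group_def)
    qed
    moreover have "?h (gen i) = g i" if "i \<in> {1..n}" for i
      using gen_in_carrier[OF that] g[OF that] by (simp add: ev_def gen_def lv_def)
    ultimately show "?h \<in> hom (free_group n) G \<inter> extensional (carrier (free_group n)) \<and>
        (\<forall>i\<in>{1..n}. ?h (gen i) = g i)" by auto
  next
    fix h assume h: "h \<in> hom (free_group n) G \<inter> extensional (carrier (free_group n)) \<and>
        (\<forall>i\<in>{1..n}. h (gen i) = g i)"
    interpret h: group_hom "free_group n" G h
      using h by unfold_locales auto
    have letter: "[a] \<in> carrier (free_group n) \<and> h [a] = lv a" if "a \<in> ?L" for a
    proof (cases "snd a")
      case True
      then have "[a] = gen (fst a)" by (simp add: gen_def prod_eq_iff)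
      then show ?thesis using that h True gen_in_carrier[of "fst a" n] by (auto simp: lv_def)
    next
      case False
      then have "[a] = inv\<^bsub>free_group n\<^esub> (gen (fst a))"
        using that inv_gen[of "fst a" n] by (auto simp: prod_eq_iff)
      then show ?thesis using that h False gen_in_carrier[of "fst a" n] by (auto simp: lv_def)
    qed
    have "h w = ev w" if "w \<in> carrier (free_group n)" for w
      using that
    proof (induction w)
      case Nil
      then show ?case using h.hom_one by (simp add: ev_def free_group_def)
    next
      case (Cons a w)
      then have w: "w \<in> carrier (free_group n)" and a: "a \<in> ?L"
        by (auto simp: free_group_def reduced_def successively_Cons)
      have "reduced (a # w)" using Cons.prems by (simp add: free_group_def)
      then have "a # w = [a] \<otimes>\<^bsub>free_group n\<^esub> w"
        by (cases w) (auto simp: free_group_def reduced_def)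
      then have "h (a # w) = h [a] \<otimes>\<^bsub>G\<^esub> h w"
        using w letter[OF a] h.hom_mult[of "[a]" w] by simp
      then show ?case using w Cons.IH letter[OF a] by (simp add: ev_Cons)
    qed
    then show "h = restrict ev (carrier (free_group n))"
      using h by (intro extensionalityI[of _ "carrier (free_group n)"]) auto
  qed
qed


section \<open>Lower central series\<close>

definition commutator_subgroup :: "('a, 'b) monoid_scheme \<Rightarrow> 'a set \<Rightarrow> 'a set \<Rightarrow> 'a set" where
  "commutator_subgroup G H K =
     generate G {h \<otimes>\<^bsub>G\<^esub> k \<otimes>\<^bsub>G\<^esub> inv\<^bsub>G\<^esub> h \<otimes>\<^bsub>G\<^esub> inv\<^bsub>G\<^esub> k | h k. h \<in> H \<and> k \<in> K}"

text \<open>The series is indexed from 1; the value at 0 is a dummy that is never used.\<close>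

fun lower_central :: "('a, 'b) monoid_scheme \<Rightarrow> nat \<Rightarrow> 'a set" where
  "lower_central G 0 = carrier G"
| "lower_central G (Suc 0) = carrier G"
| "lower_central G (Suc (Suc j)) =
     commutator_subgroup G (carrier G) (lower_central G (Suc j))"


section \<open>Automorphisms of \<open>F\<^sub>n\<close>\<close>

text \<open>
  \<^const>\<open>AutoGroup\<close> consists of automorphisms that are extensional on the carrier; its product
  is composition, the right factor being applied first.
\<close>

definition conj_by :: "('a, 'b) monoid_scheme \<Rightarrow> 'a \<Rightarrow> 'a \<Rightarrow> 'a" where
  "conj_by G x w = inv\<^bsub>G\<^esub> w \<otimes>\<^bsub>G\<^esub> x \<otimes>\<^bsub>G\<^esub> w"

definition Inn :: "('a, 'b) monoid_scheme \<Rightarrow> ('a \<Rightarrow> 'a) set" where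
  "Inn G = {(\<lambda>x\<in>carrier G. conj_by G x w) | w. w \<in> carrier G}"

text \<open>
  Triviality on the abelianization, the quotient by the derived subgroup, says that \<open>g\<close> and its
  image always lie in the same coset.
\<close>

definition IA :: "nat \<Rightarrow> (letter list \<Rightarrow> letter list) set" where
  "IA n = {\<phi> \<in> auto (free_group n). \<forall>g\<in>carrier (free_group n).
     derived (free_group n) (carrier (free_group n)) #>\<^bsub>free_group n\<^esub> \<phi> g =
     derived (free_group n) (carrier (free_group n)) #>\<^bsub>free_group n\<^esub> g}"

definition IA_group :: "nat \<Rightarrow> (letter list \<Rightarrow> letter list) monoid" where
  "IA_group n = (AutoGroup (free_group n))\<lparr>carrier := IA n\<rparr>"

lemma mult_AutoGroup:
  "\<phi> \<in> auto G \<Longrightarrow> \<psi> \<in> auto G \<Longrightarrow> \<phi> \<otimes>\<^bsub>AutoGroup G\<^esub> \<psi> = compose (carrier G) \<phi> \<psi>"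
  by (simp add: AutoGroup_def BijGroup_def auto_def)

lemma subgroup_IA: "subgroup (IA n) (AutoGroup (free_group n))"
proof -
  interpret F: group "free_group n" by (rule group_free_group)
  interpret A: group "AutoGroup (free_group n)" by (rule F.AutoGroup)
  have carr: "carrier (AutoGroup (free_group n)) = auto (free_group n)"
    by (simp add: AutoGroup_def)
  have closed: "\<phi> g \<in> carrier (free_group n)"
    if "\<phi> \<in> auto (free_group n)" "g \<in> carrier (free_group n)" for \<phi> g
    using that by (auto simp: auto_def hom_def)
  show ?thesis
  proof (rule A.subgroupI)
    show "IA n \<subseteq> carrier (AutoGroup (free_group n))"
      by (auto simp: IA_def carr)
    have "(\<lambda>g\<in>carrier (free_group n). g) \<in> IA n"
      by (simp add: IA_def F.id_in_auto)
    then show "IA n \<noteq> {}" by blast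
  next
    fix \<phi> \<psi> assume \<phi>: "\<phi> \<in> IA n" and \<psi>: "\<psi> \<in> IA n"
    then have "\<phi> \<otimes>\<^bsub>AutoGroup (free_group n)\<^esub> \<psi> \<in> auto (free_group n)"
      using A.m_closed[of \<phi> \<psi>] by (simp add: carr IA_def)
    with \<phi> \<psi> show "\<phi> \<otimes>\<^bsub>AutoGroup (free_group n)\<^esub> \<psi> \<in> IA n"
      by (simp add: IA_def mult_AutoGroup closed compose_eq)
  next
    fix \<phi> assume \<phi>: "\<phi> \<in> IA n"
    define \<psi> where "\<psi> = inv\<^bsub>AutoGroup (free_group n)\<^esub> \<phi>"
    have au: "\<phi> \<in> auto (free_group n)" using \<phi> by (simp add: IA_def)
    then have \<psi>: "\<psi> \<in> auto (free_group n)"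
      unfolding \<psi>_def using A.inv_closed[of \<phi>] by (simp add: carr)
    have "\<phi> \<otimes>\<^bsub>AutoGroup (free_group n)\<^esub> \<psi> = \<one>\<^bsub>AutoGroup (free_group n)\<^esub>"
      unfolding \<psi>_def using au A.r_inv[of \<phi>] by (simp add: carr)
    then have "compose (carrier (free_group n)) \<phi> \<psi> = (\<lambda>g\<in>carrier (free_group n). g)"
      using au \<psi> by (simp add: mult_AutoGroup) (simp add: AutoGroup_def BijGroup_def)
    then have "\<phi> (\<psi> g) = g" if "g \<in> carrier (free_group n)" for g
      using that by (metis compose_eq restrict_apply')
    then show "inv\<^bsub>AutoGroup (free_group n)\<^esub> \<phi> \<in> IA n"
      using \<phi> \<psi> closed[OF \<psi>] unfolding \<psi>_def[symmetric] IA_def by simp metis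
  qed
qed

lemma group_IA_group: "group (IA_group n)"
  unfolding IA_group_def
  by (rule subgroup.subgroup_is_group[OF subgroup_IA])
    (rule group.AutoGroup[OF group_free_group])

definition triangular_McCool :: "nat \<Rightarrow> (letter list \<Rightarrow> letter list) set" where
  "triangular_McCool n = {\<phi> \<in> auto (free_group n).
     \<exists>w. \<forall>i\<in>{1..n}. w i \<in> generate (free_group n) (gen ` {1..<i}) \<and>
                    \<phi> (gen i) = conj_by (free_group n) (gen i) (w i)}"

definition partial_inner :: "nat \<Rightarrow> (letter list \<Rightarrow> letter list) set" where
  "partial_inner n =
     Inn (free_group n) <#>\<^bsub>AutoGroup (free_group n)\<^esub> triangular_McCool n"

definition andreadakis_filtration :: "nat \<Rightarrow> nat \<Rightarrow> (letter list \<Rightarrow> letter list) set" where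
  "andreadakis_filtration n j = {\<phi> \<in> auto (free_group n).
     \<forall>i\<ge>1. \<forall>g\<in>lower_central (free_group n) i.
       \<phi> g \<otimes>\<^bsub>free_group n\<^esub> inv\<^bsub>free_group n\<^esub> g \<in> lower_central (free_group n) (i + j)}"

definition satisfies_andreadakis_equality ::
    "nat \<Rightarrow> (letter list \<Rightarrow> letter list) set \<Rightarrow> bool" where
  "satisfies_andreadakis_equality n K \<longleftrightarrow>
     subgroup K (IA_group n) \<and>
     (\<forall>j\<ge>1. lower_central ((IA_group n)\<lparr>carrier := K\<rparr>) j = K \<inter> lower_central (IA_group n) j \<and>
            K \<inter> lower_central (IA_group n) j = K \<inter> andreadakis_filtration n j)"

end

theory Submission
  imports Defs "HOL-Library.List_Lexorder"
begin

text \<open>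
  The only deep inclusion is \<open>I\<^sub>n \<inter> \<A>\<^sub>j \<subseteq> \<Gamma>\<^sub>j(I\<^sub>n)\<close>. Up to a power of the conjugation by
  \<open>x\<^sub>1\<close>, which is both inner and triangular, every element of \<open>I\<^sub>n\<close> is a conjugation by some \<open>u\<close>
  composed with a triangular \<open>\<psi>\<close> that fixes \<open>x\<^sub>1\<close> and \<open>x\<^sub>2\<close>. If the product lies in \<open>\<A>\<^sub>j\<close>, then \<open>u\<close>
  commutes with \<open>x\<^sub>1\<close> and \<open>x\<^sub>2\<close> modulo \<open>\<Gamma>\<^sub>j\<^sub>+\<^sub>1(F\<^sub>n)\<close>, and centralizers in the free Lie ring force
  \<open>u \<in> \<Gamma>\<^sub>j(F\<^sub>n)\<close>. So \<open>\<psi> \<in> \<A>\<^sub>j\<close>, and if \<open>\<psi>(x\<^sub>i) = x\<^sub>i\<^sup>w\<close>, where \<open>w = w\<^sub>i\<close> involves only \<open>x\<^sub>k\<close> with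
  \<open>k < i\<close>, then \<open>w\<close> commutes with \<open>x\<^sub>i\<close> modulo \<open>\<Gamma>\<^sub>j\<^sub>+\<^sub>1(F\<^sub>n)\<close> and again \<open>w \<in> \<Gamma>\<^sub>j(F\<^sub>i\<^sub>-\<^sub>1)\<close>. As \<open>\<psi>\<close> is the
  product of the automorphisms \<open>x\<^sub>i \<mapsto> x\<^sub>i\<^sup>w\<close>, which depend homomorphically on \<open>w\<close>, it lies in \<open>\<Gamma>\<^sub>j(I\<^sub>n)\<close>.

  The centralizers are read off from the Magnus expansion, whose leading part is injective on
  \<open>\<Gamma>\<^sub>k(F\<^sub>n)/\<Gamma>\<^sub>k\<^sub>+\<^sub>1(F\<^sub>n)\<close>: this quotient is spanned by the brackets of Lyndon words, and the Lie polynomial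
  of such a bracket is the Lyndon word plus lexicographically greater words.
\<close>

section \<open>Commutator calculus\<close>

context group
begin

definition commutator :: "'a \<Rightarrow> 'a \<Rightarrow> 'a" where
  "commutator x y = x \<otimes> y \<otimes> inv x \<otimes> inv y"

lemma cancel_inv_left: "x \<in> carrier G \<Longrightarrow> y \<in> carrier G \<Longrightarrow> inv x \<otimes> (x \<otimes> y) = y"
  by (simp add: m_assoc [symmetric])

lemma cancel_left_inv: "x \<in> carrier G \<Longrightarrow> y \<in> carrier G \<Longrightarrow> x \<otimes> (inv x \<otimes> y) = y"
  by (simp add: m_assoc [symmetric])

text \<open>Together with the inverse laws these bring a word to right-associated, freely reduced
  form, so \<open>simp\<close> settles identities that hold in every group.\<close>

lemmas word_simps = m_assoc inv_mult_group cancel_inv_left cancel_left_inv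

lemma commutator_closed [simp, intro]:
  "x \<in> carrier G \<Longrightarrow> y \<in> carrier G \<Longrightarrow> commutator x y \<in> carrier G"
  by (simp add: commutator_def)

lemma inv_commutator:
  "x \<in> carrier G \<Longrightarrow> y \<in> carrier G \<Longrightarrow> inv (commutator x y) = commutator y x"
  by (simp add: commutator_def word_simps)

lemma commutator_self: "x \<in> carrier G \<Longrightarrow> commutator x x = \<one>"
  by (simp add: commutator_def word_simps)

lemma commutator_one [simp]: "x \<in> carrier G \<Longrightarrow> commutator \<one> x = \<one>"
  by (simp add: commutator_def word_simps)

lemma commutator_mult_swap:
  "x \<in> carrier G \<Longrightarrow> y \<in> carrier G \<Longrightarrow> commutator x y \<otimes> (y \<otimes> x) = x \<otimes> y"
  by (simp add: commutator_def word_simps)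

lemma commutator_mult_left:
  assumes "x \<in> carrier G" "y \<in> carrier G" "z \<in> carrier G"
  shows "commutator (x \<otimes> y) z = x \<otimes> commutator y z \<otimes> inv x \<otimes> commutator x z"
  using assms by (simp add: commutator_def word_simps)

lemma commutator_inv_left:
  assumes "x \<in> carrier G" "z \<in> carrier G"
  shows "commutator (inv x) z = inv x \<otimes> commutator z x \<otimes> inv (inv x)"
  using assms by (simp add: commutator_def word_simps)

text \<open>The Hall-Witt identity, solved for the last of its three factors.\<close>

lemma hall_witt:
  assumes "x \<in> carrier G" "y \<in> carrier G" "z \<in> carrier G"
  shows "commutator z (commutator (inv x) y) =
     inv x \<otimes> inv ((y \<otimes> commutator x (commutator (inv y) z) \<otimes> inv y) \<otimes>
       (z \<otimes> commutator y (commutator (inv z) x) \<otimes> inv z)) \<otimes> x"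
  using assms by (simp add: commutator_def word_simps)

lemma normal_conj_mem:
  assumes "M \<lhd> G" "x \<in> carrier G" "m \<in> M"
  shows "x \<otimes> m \<otimes> inv x \<in> M"
  using assms normal.inv_op_closed2 by metis

lemma normal_commutator_swap:
  assumes "M \<lhd> G" "x \<in> carrier G" "y \<in> carrier G" "commutator x y \<in> M"
  shows "commutator y x \<in> M"
  using assms inv_commutator[of x y] subgroup.m_inv_closed[OF normal_imp_subgroup[OF assms(1)] assms(4)]
  by simp

lemma normal_commutator_inv_left:
  assumes "M \<lhd> G" "x \<in> carrier G" "y \<in> carrier G" "commutator x y \<in> M"
  shows "commutator (inv x) y \<in> M"
  using assms normal_conj_mem[of M "inv x" "commutator y x"] normal_commutator_swap[OF assms]
  by (simp add: commutator_inv_left)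

lemma normal_commutator_mult_left:
  assumes "M \<lhd> G" "x \<in> carrier G" "y \<in> carrier G" "z \<in> carrier G"
    "commutator x z \<in> M" "commutator y z \<in> M"
  shows "commutator (x \<otimes> y) z \<in> M"
  using assms normal_conj_mem[of M x "commutator y z"] normal_imp_subgroup[OF assms(1)]
  by (simp add: commutator_mult_left subgroup.m_closed)

text \<open>The three subgroups lemma for single elements: by \<open>hall_witt\<close> the third
  commutator is a conjugate of the inverse of a product of conjugates of the other two.\<close>

lemma normal_three_commutators:
  assumes M: "M \<lhd> G" and xyz: "x \<in> carrier G" "y \<in> carrier G" "z \<in> carrier G"
    and 1: "commutator x (commutator (inv y) z) \<in> M"
    and 2: "commutator y (commutator (inv z) x) \<in> M"
  shows "commutator z (commutator (inv x) y) \<in> M"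
proof -
  note sg = normal_imp_subgroup[OF M]
  let ?m = "inv ((y \<otimes> commutator x (commutator (inv y) z) \<otimes> inv y) \<otimes>
       (z \<otimes> commutator y (commutator (inv z) x) \<otimes> inv z))"
  have "?m \<in> M"
    by (rule subgroup.m_inv_closed[OF sg subgroup.m_closed[OF sg
          normal_conj_mem[OF M xyz(2) 1] normal_conj_mem[OF M xyz(3) 2]]])
  from normal_conj_mem[OF M _ this, of "inv x"] show ?thesis
    using xyz by (simp only: hall_witt [OF xyz] inv_closed inv_inv)
qed

section \<open>The lower central series\<close>

lemma lower_central_Suc:
  assumes "k \<ge> 1"
  shows "lower_central G (Suc k) =
    generate G {commutator x y | x y. x \<in> carrier G \<and> y \<in> lower_central G k}"
  using assms by (cases k) (auto simp: commutator_subgroup_def commutator_def)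

lemma lower_central_sub_carrier: "lower_central G k \<subseteq> carrier G"
proof (induction k)
  case (Suc k)
  show ?case
  proof (cases "k \<ge> 1")
    case True
    then show ?thesis unfolding lower_central_Suc[OF True]
      using Suc by (intro generate_incl) auto
  qed (simp add: not_le)
qed simp

lemma lower_central_subgroup: "subgroup (lower_central G k) G"
proof (cases "k \<le> 1")
  case True
  then show ?thesis using subgroup_self by (cases k) auto
next
  case False
  then obtain j where j: "k = Suc j" "j \<ge> 1" by (cases k) auto
  show ?thesis unfolding j(1) lower_central_Suc[OF j(2)]
    using lower_central_sub_carrier[of j] by (intro generate_is_subgroup) auto
qed

text \<open>At \<open>k = 0\<close> both terms are the whole group, which lets
  \<open>commutator_lower_central\<close> hold without lower bounds on the indices.\<close>

lemma commutator_lower_central_Suc: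
  assumes "x \<in> carrier G" "y \<in> lower_central G k"
  shows "commutator x y \<in> lower_central G (Suc k)"
proof (cases "k \<ge> 1")
  case True
  then show ?thesis unfolding lower_central_Suc[OF True]
    using assms by (auto intro!: generate.incl)
qed (use assms in \<open>auto simp: not_le\<close>)

lemma lower_central_le_Suc: "lower_central G (Suc k) \<subseteq> lower_central G k"
proof (induction k)
  case (Suc k)
  show ?case
  proof (cases "k \<ge> 1")
    case True
    have "generate G {commutator x y | x y. x \<in> carrier G \<and> y \<in> lower_central G (Suc k)}
      \<subseteq> generate G {commutator x y | x y. x \<in> carrier G \<and> y \<in> lower_central G k}"
      using Suc by (intro mono_generate) blast
    then show ?thesis
      using lower_central_Suc[of "Suc k"] lower_central_Suc[OF True] by simp
  qed (use lower_central_sub_carrier[of "Suc (Suc 0)"] in \<open>simp add: not_le\<close>)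
qed simp

lemma lower_central_antimono: "i \<le> j \<Longrightarrow> lower_central G j \<subseteq> lower_central G i"
  by (rule lift_Suc_antimono_le[where f = "lower_central G"]) (rule lower_central_le_Suc)

text \<open>Conjugation by \<open>x\<close> multiplies \<open>h\<close> by
  \<open>commutator x h\<close>, which lies in Gamma_(k+1) and so in \<open>M\<close>.\<close>

lemma intermediate_normal:
  assumes "subgroup M G" "M \<subseteq> lower_central G k" "lower_central G (Suc k) \<subseteq> M"
  shows "M \<lhd> G"
  unfolding normal_inv_iff
proof (intro conjI ballI assms)
  fix x h assume x: "x \<in> carrier G" and h: "h \<in> M"
  have hG: "h \<in> carrier G" using h subgroup.subset[OF assms(1)] by blast
  have "commutator x h \<otimes> h \<in> M"
    using x h assms commutator_lower_central_Suc[of x h k]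
    by (intro subgroup.m_closed[OF assms(1)]) auto
  then show "x \<otimes> h \<otimes> inv x \<in> M"
    using x hG by (simp add: commutator_def word_simps)
qed

lemma lower_central_normal: "lower_central G k \<lhd> G"
  by (rule intermediate_normal[OF lower_central_subgroup subset_refl lower_central_le_Suc])

text \<open>The elements commuting with \<open>z\<close> modulo a normal \<open>M\<close> form a
  subgroup, so it suffices to test generators.\<close>

lemma generate_commutator_mem:
  assumes M: "M \<lhd> G" and S: "S \<subseteq> carrier G" and z: "z \<in> carrier G"
    and mem: "\<And>s. s \<in> S \<Longrightarrow> commutator s z \<in> M" and h: "h \<in> generate G S"
  shows "commutator h z \<in> M"
  using h
proof (induction rule: generate.induct)
  case one
  then show ?case using z normal_imp_subgroup[OF M] by (simp add: subgroup.one_closed)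
next
  case (inv h)
  then show ?case using mem S z by (intro normal_commutator_inv_left[OF M]) auto
next
  case (eng h1 h2)
  then show ?case using generate_in_carrier[OF S] z by (intro normal_commutator_mult_left[OF M])
qed (rule mem)

text \<open>Induction on \<open>i\<close>. For a generator [g, a] of Gamma_(i+1), the three
  commutators lemma reduces [y, [g, a]] to [g^-1, [a^-1, y]] and [a, [y^-1, g^-1]]. The latter uses
  the induction hypothesis at \<open>Suc j\<close>, hence \<open>j\<close> is arbitrary.\<close>

theorem commutator_lower_central:
  assumes "x \<in> lower_central G i" "y \<in> lower_central G j"
  shows "commutator x y \<in> lower_central G (i + j)"
  using assms
proof (induction i arbitrary: j x y)
  case 0
  then show ?case
    using commutator_lower_central_Suc[of x y j] lower_central_le_Suc[of j] by auto
next
  case (Suc i)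
  note N = lower_central_normal and sub = lower_central_sub_carrier[THEN subsetD]
  show ?case
  proof (cases "i \<ge> 1")
    case True
    show ?thesis
    proof (rule generate_commutator_mem[OF N])
      show "x \<in> generate G {commutator x y | x y. x \<in> carrier G \<and> y \<in> lower_central G i}"
        using Suc.prems(1) lower_central_Suc[OF True] by simp
      show "y \<in> carrier G" using Suc.prems(2) sub by blast
      fix s assume "s \<in> {commutator x y | x y. x \<in> carrier G \<and> y \<in> lower_central G i}"
      then obtain g a where s: "s = commutator g a" and g: "g \<in> carrier G" and a: "a \<in> lower_central G i"
        by blast
      have aG: "a \<in> carrier G" and yG: "y \<in> carrier G"
        using a Suc.prems(2) sub by blast+
      have ay: "commutator (inv a) y \<in> lower_central G (i + j)"
        using Suc.IH[of a y j] a aG yG Suc.prems(2)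
        by (intro normal_commutator_inv_left[OF N]) auto
      have "commutator (inv y) (inv g) \<in> lower_central G (Suc j)"
        using g yG normal_commutator_swap[OF N _ _ commutator_lower_central_Suc[OF _ Suc.prems(2)], of "inv g"]
        by (intro normal_commutator_inv_left[OF N]) auto
      then have 2: "commutator a (commutator (inv y) (inv g)) \<in> lower_central G (Suc (i + j))"
        using Suc.IH[OF a, of _ "Suc j"] by simp
      have 1: "commutator (inv g) (commutator (inv a) y) \<in> lower_central G (Suc (i + j))"
        using ay g by (intro commutator_lower_central_Suc) auto
      have "commutator y (commutator (inv (inv g)) a) \<in> lower_central G (Suc (i + j))"
        by (rule normal_three_commutators[OF N _ aG yG 1 2]) (use g in simp)
      then show "commutator s y \<in> lower_central G (Suc i + j)"
        using g aG yG s normal_commutator_swap[OF N, of y "commutator g a" "Suc (i + j)"] by simp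
    qed (use sub in auto)
  next
    case False
    then have "i = 0" by simp
    then have "x \<in> carrier G" "Suc i + j = Suc j" using Suc.prems by auto
    then show ?thesis using commutator_lower_central_Suc Suc.prems(2) by simp
  qed
qed

end

text \<open>Functoriality of the series. Homomorphisms out of the free group will later supply
  elements of the lower central series of the partial inner group.\<close>

lemma hom_lower_central:
  assumes "group G" "group H" "f \<in> hom G H" "x \<in> lower_central G k"
  shows "f x \<in> lower_central H k"
  using assms(4)
proof (induction k arbitrary: x)
  case 0
  then show ?case using assms by (auto simp: hom_def)
next
  case (Suc k)
  interpret f: group_hom G H f using assms by (simp add: group_hom_def group_hom_axioms_def)
  interpret L: subgroup "lower_central H (Suc k)" H by (rule f.H.lower_central_subgroup)
  show ?case
  proof (cases "k \<ge> 1")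
    case True
    have "x \<in> generate G {f.G.commutator x y | x y. x \<in> carrier G \<and> y \<in> lower_central G k}"
      using Suc.prems f.G.lower_central_Suc[OF True] by simp
    moreover have sub: "{f.G.commutator x y | x y. x \<in> carrier G \<and> y \<in> lower_central G k} \<subseteq> carrier G"
      using f.G.lower_central_sub_carrier[of k] by auto
    moreover have c: "f s \<in> lower_central H (Suc k)"
      if s: "s \<in> {f.G.commutator x y | x y. x \<in> carrier G \<and> y \<in> lower_central G k}" for s
    proof -
      obtain x y where xy: "s = f.G.commutator x y" "x \<in> carrier G" "y \<in> lower_central G k"
        using s by blast
      then have "f s = f.H.commutator (f x) (f y)"
        using f.G.lower_central_sub_carrier[of k] by (auto simp: f.G.commutator_def f.H.commutator_def)
      then show ?thesis using xy Suc.IH by (simp add: f.H.commutator_lower_central_Suc)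
    qed
    ultimately show ?thesis
    proof (induction rule: generate.induct)
      case (inv h)
      then have "h \<in> carrier G" by blast
      then show ?case using c[OF inv.hyps] by simp
    next
      case (eng h1 h2)
      then show ?case using f.G.generate_in_carrier[OF sub] by simp
    qed auto
  next
    case False
    then show ?thesis using Suc.prems by (auto simp: not_le)
  qed
qed

section \<open>Lyndon words and their bracketings\<close>

datatype bracket = Leaf nat | Br bracket bracket

primrec foliage :: "bracket \<Rightarrow> nat list" where
  "foliage (Leaf i) = [i]"
| "foliage (Br s t) = foliage s @ foliage t"

text \<open>The foliages of these bracketings are the Lyndon words, and \<open>Br s t\<close> corresponds to the standard
  factorization of its foliage.\<close>

fun hall :: "bracket \<Rightarrow> bool" where
  "hall (Leaf i) \<longleftrightarrow> True"
| "hall (Br (Leaf i) t) \<longleftrightarrow> hall t \<and> [i] < foliage t"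
| "hall (Br (Br u v) t) \<longleftrightarrow> hall (Br u v) \<and> hall t \<and> foliage u @ foliage v < foliage t \<and>
     foliage t \<le> foliage v"

lemma foliage_nonempty [simp]: "foliage t \<noteq> []"
  by (induction t) auto

lemma length_foliage_pos [simp]: "0 < length (foliage t)"
  by simp

lemma hall_Br_D: "hall (Br s t) \<Longrightarrow> hall s \<and> hall t \<and> foliage s < foliage t"
  by (cases s) auto

lemma le_append: "(u :: nat list) \<le> u @ v"
  by (induction u) auto

lemma append_le_append:
  fixes u v :: "nat list"
  assumes "length u = length u'" "u \<le> u'" "v \<le> v'"
  shows "u @ v \<le> u' @ v'"
  using assms by (induction u u' rule: list_induct2) auto

lemma append_less_cancel [simp]: "(u :: nat list) @ v < u @ w \<longleftrightarrow> v < w"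
  by (induction u) auto

text \<open>The comparison is decided at a position inside \<open>u\<close>, so appending to
  \<open>u\<close> does not affect it.\<close>

lemma less_not_prefix:
  fixes u v :: "nat list"
  assumes "u < v" "\<nexists>z. v = u @ z"
  shows "u @ w < v"
  using assms
proof (induction u arbitrary: v)
  case (Cons a u)
  then show ?case by (cases v) auto
qed auto

text \<open>The last assumption says that \<open>v\<close> is a Lyndon word (or empty).\<close>

lemma append_less_right:
  fixes u v :: "nat list"
  assumes "u < v" "u \<noteq> []" "\<And>x y. v = x @ y \<Longrightarrow> y \<noteq> [] \<Longrightarrow> v \<le> y"
  shows "u @ v < v"
proof (cases "\<exists>z. v = u @ z")
  case True
  then obtain z where z: "v = u @ z" by blast
  then have "z \<noteq> []" using assms(1) by auto
  then have "v \<le> z" using assms(3) z by blast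
  moreover have "v \<noteq> z" using z assms(2) by simp
  ultimately show ?thesis using z by (metis append_less_cancel order_le_less)
qed (use assms(1) less_not_prefix in blast)

text \<open>A proper suffix of the word of \<open>Br s t\<close> either lies within
  \<open>foliage t\<close>, or starts with a proper suffix \<open>z\<close> of the word of
  \<open>s = Br u v\<close>. In the second case the Hall condition and the induction hypothesis give
  \<open>foliage t \<le> foliage v \<le> z\<close>.\<close>

lemma hall_suffix:
  assumes "hall t" "foliage t = x @ y" "y \<noteq> []"
  shows "foliage t \<le> y \<and> (\<forall>r s. t = Br r s \<longrightarrow> x \<noteq> [] \<longrightarrow> foliage s \<le> y)"
  using assms
proof (induction t arbitrary: x y)
  case (Leaf i)
  then show ?case by (cases x) auto
next
  case (Br s t)
  note h = hall_Br_D[OF Br.prems(1)]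
  have lt: "foliage s @ foliage t < foliage t"
    using h Br.IH(2) by (intro append_less_right) auto
  have suff: "foliage t \<le> y" if x: "x \<noteq> []"
  proof -
    consider (right) z where "foliage t = z @ y" | (left) z where "foliage s = x @ z" "z \<noteq> []" "y = z @ foliage t"
      using Br.prems(2) by (auto simp: append_eq_append_conv2) (metis append.right_neutral append_Nil)
    then show ?thesis
    proof cases
      case right
      then show ?thesis using Br.IH(2) h Br.prems(3) by blast
    next
      case left
      obtain u v where s: "s = Br u v"
        using left x by (cases s) (auto simp: Cons_eq_append_conv)
      then have "foliage v \<le> z" using Br.IH(1) h left x by blast
      moreover have "foliage t \<le> foliage v" using Br.prems(1) s by simp
      moreover have "z \<le> y" using left le_append by blast
      ultimately show ?thesis by (meson order_trans)
    qed
  qed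
  then show ?case
    using lt Br.prems(2) by (cases "x = []") auto
qed

lemma hall_foliage_append_less: "hall s \<Longrightarrow> hall t \<Longrightarrow> foliage s < foliage t \<Longrightarrow> foliage s @ foliage t < foliage t"
  using hall_suffix[of t] by (intro append_less_right) auto

text \<open>By \<open>hall_suffix\<close> both right factors are the least proper suffix of the
  common word, so the two factorizations coincide.\<close>

lemma hall_foliage_inject: "hall s \<Longrightarrow> hall t \<Longrightarrow> foliage s = foliage t \<Longrightarrow> s = t"
proof (induction s arbitrary: t)
  case (Leaf i)
  then show ?case by (cases t) (auto simp: Cons_eq_append_conv)
next
  case (Br a b)
  then obtain c d where t: "t = Br c d"
    by (cases t) (auto simp: append_eq_Cons_conv)
  have "foliage b \<le> foliage d" "foliage d \<le> foliage b"
    using hall_suffix[OF Br.prems(1), of "foliage c" "foliage d"]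
      hall_suffix[OF Br.prems(2), of "foliage a" "foliage b"] Br.prems(3) t by auto
  then have "foliage b = foliage d" by simp
  then show ?case using Br hall_Br_D t by (metis append_same_eq foliage.simps(2))
qed

text \<open>The coefficients of the Lie polynomial of a bracketing.\<close>

primrec lie_coeff :: "bracket \<Rightarrow> nat list \<Rightarrow> int" where
  "lie_coeff (Leaf i) w = (if w = [i] then 1 else 0)"
| "lie_coeff (Br s t) w =
     lie_coeff s (take (length (foliage s)) w) * lie_coeff t (drop (length (foliage s)) w) -
     lie_coeff t (take (length (foliage t)) w) * lie_coeff s (drop (length (foliage t)) w)"

text \<open>Triangularity for the lexicographic order. By induction the words of the product of
  \<open>s\<close> and \<open>t\<close> are at least \<open>foliage s @ foliage t\<close>, and those
  of the reversed product at least \<open>foliage t @ foliage s\<close>. The latter is strictly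
  greater, so it cannot cancel the leading coefficient.\<close>

lemma lie_coeff_hall:
  assumes "hall t"
  shows "lie_coeff t (foliage t) = 1"
    and "\<And>w. length w = length (foliage t) \<Longrightarrow> lie_coeff t w \<noteq> 0 \<Longrightarrow> foliage t \<le> w"
proof -
  have "lie_coeff t (foliage t) = 1 \<and>
    (\<forall>w. length w = length (foliage t) \<longrightarrow> lie_coeff t w \<noteq> 0 \<longrightarrow> foliage t \<le> w)"
    using assms
  proof (induction t)
    case (Br s t)
    note h = hall_Br_D[OF Br.prems]
    have "foliage s @ foliage t < foliage t"
      using h hall_foliage_append_less by blast
    also have "foliage t \<le> foliage t @ foliage s" by (rule le_append)
    finally have lt: "foliage s @ foliage t < foliage t @ foliage s" .
    have ge: "foliage a @ foliage b \<le> w"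
      if "lie_coeff a (take (length (foliage a)) w) * lie_coeff b (drop (length (foliage a)) w) \<noteq> 0"
        "length w = length (foliage a) + length (foliage b)" "{a, b} = {s, t}" for a b w
    proof -
      have "foliage a @ foliage b \<le> take (length (foliage a)) w @ drop (length (foliage a)) w"
        using that Br.IH h by (intro append_le_append) (auto simp: doubleton_eq_iff)
      then show ?thesis by simp
    qed
    show ?case
    proof (intro conjI allI impI)
      show "lie_coeff (Br s t) (foliage (Br s t)) = 1"
        using ge[where a = t and b = s and w = "foliage s @ foliage t"] lt Br.IH h by force
      fix w assume "length w = length (foliage (Br s t))" "lie_coeff (Br s t) w \<noteq> 0"
      then show "foliage (Br s t) \<le> w"
        using ge[where a = s and b = t and w = w] ge[where a = t and b = s and w = w] lt
        by (cases "lie_coeff s (take (length (foliage s)) w) * lie_coeff t (drop (length (foliage s)) w) = 0")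
          (auto simp: insert_commute)
    qed
  qed auto
  then show "lie_coeff t (foliage t) = 1"
    and "\<And>w. length w = length (foliage t) \<Longrightarrow> lie_coeff t w \<noteq> 0 \<Longrightarrow> foliage t \<le> w" by auto
qed

section \<open>Brackets of Lyndon words span the lower central series\<close>

definition hall_brackets :: "nat set \<Rightarrow> nat \<Rightarrow> bracket set" where
  "hall_brackets A k = {t. hall t \<and> set (foliage t) \<subseteq> A \<and> length (foliage t) = k}"

lemma finite_hall_brackets: "finite A \<Longrightarrow> finite (hall_brackets A k)"
proof (rule finite_imageD[of foliage])
  assume "finite A"
  then show "finite (foliage ` hall_brackets A k)"
    by (rule finite_subset[OF _ finite_lists_length_eq[of A k], rotated]) (auto simp: hall_brackets_def)
  show "inj_on foliage (hall_brackets A k)"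
    by (rule inj_onI) (auto simp: hall_brackets_def intro: hall_foliage_inject)
qed

context group
begin

primrec bracket_val :: "(nat \<Rightarrow> 'a) \<Rightarrow> bracket \<Rightarrow> 'a" where
  "bracket_val g (Leaf i) = g i"
| "bracket_val g (Br s t) = commutator (bracket_val g s) (bracket_val g t)"

lemma bracket_val_lower_central:
  "g ` set (foliage t) \<subseteq> carrier G \<Longrightarrow> bracket_val g t \<in> lower_central G (length (foliage t))"
  by (induction t) (auto intro: commutator_lower_central)

text \<open>Adjoining Gamma_(k+1) expresses spans in the quotient Gamma_k/Gamma_(k+1) by subgroups
  of \<open>G\<close>, so that no quotient group has to be formed.\<close>

definition bracket_span :: "(nat \<Rightarrow> 'a) \<Rightarrow> bracket set \<Rightarrow> nat \<Rightarrow> 'a set" where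
  "bracket_span g S k = generate G (bracket_val g ` S \<union> lower_central G (Suc k))"

lemma bracket_span_mono: "S \<subseteq> T \<Longrightarrow> bracket_span g S k \<subseteq> bracket_span g T k"
  unfolding bracket_span_def by (intro mono_generate) auto

lemma lower_central_Suc_subset_bracket_span: "lower_central G (Suc k) \<subseteq> bracket_span g S k"
  unfolding bracket_span_def by (auto intro: generate.incl)

lemma bracket_val_in_span: "t \<in> S \<Longrightarrow> bracket_val g t \<in> bracket_span g S k"
  unfolding bracket_span_def by (auto intro: generate.incl)

context
  fixes g :: "nat \<Rightarrow> 'a" and A :: "nat set"
  assumes g: "g ` A \<subseteq> carrier G"
begin

lemma hall_bracket_val:
  "t \<in> hall_brackets A k \<Longrightarrow> bracket_val g t \<in> lower_central G k"
  using g bracket_val_lower_central[of g t] by (fastforce simp: hall_brackets_def)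

lemma bracket_span_subset:
  assumes "S \<subseteq> hall_brackets A k"
  shows "bracket_span g S k \<subseteq> lower_central G k"
  unfolding bracket_span_def
  using assms hall_bracket_val lower_central_le_Suc
  by (intro generate_subgroup_incl lower_central_subgroup) blast

lemma bracket_span_normal:
  assumes "S \<subseteq> hall_brackets A k"
  shows "bracket_span g S k \<lhd> G"
proof (rule intermediate_normal[OF _ bracket_span_subset[OF assms] lower_central_Suc_subset_bracket_span])
  show "subgroup (bracket_span g S k) G"
    unfolding bracket_span_def
    using assms hall_bracket_val lower_central_sub_carrier
    by (intro generate_is_subgroup) blast
qed

text \<open>Commutators of \<open>y\<close> with the adjoined Gamma_(j+1) fall into Gamma_(i+j+1)
  and hence into \<open>M\<close>; only the brackets in \<open>S\<close> remain to be
  tested.\<close>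

lemma commutator_bracket_span:
  assumes S: "S \<subseteq> hall_brackets A j" and y: "y \<in> lower_central G i"
    and M: "M \<lhd> G" "lower_central G (Suc (i + j)) \<subseteq> M"
    and mem: "\<And>x. x \<in> S \<Longrightarrow> commutator y (bracket_val g x) \<in> M"
    and h: "h \<in> bracket_span g S j"
  shows "commutator y h \<in> M"
proof -
  note sub = lower_central_sub_carrier[THEN subsetD]
  have yG: "y \<in> carrier G" using y sub by blast
  have c: "s \<in> carrier G \<and> commutator s y \<in> M"
    if "s \<in> bracket_val g ` S \<union> lower_central G (Suc j)" for s
    using that
  proof
    assume "s \<in> bracket_val g ` S"
    then obtain x where "s = bracket_val g x" "x \<in> S" by blast
    then show ?thesis
      using mem S hall_bracket_val sub yG normal_commutator_swap[OF M(1) yG, of "bracket_val g x"]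
      by blast
  next
    assume s: "s \<in> lower_central G (Suc j)"
    then have "commutator s y \<in> lower_central G (Suc j + i)"
      using y by (rule commutator_lower_central)
    then show ?thesis using M(2) s sub by (auto simp: add.commute)
  qed
  have "commutator h y \<in> M"
  proof (rule generate_commutator_mem[OF M(1) _ yG])
    show "bracket_val g ` S \<union> lower_central G (Suc j) \<subseteq> carrier G" using c by blast
    show "h \<in> generate G (bracket_val g ` S \<union> lower_central G (Suc j))"
      using h by (simp add: bracket_span_def)
  qed (use c in blast)
  moreover have "h \<in> carrier G"
    using h bracket_span_subset[OF S] sub by blast
  ultimately show ?thesis using normal_commutator_swap[OF M(1) _ yG, of h] by simp
qed

text \<open>Hall's rewriting: if the bracket of \<open>s = (u, v)\<close> and \<open>t\<close> is not itself a Hall bracket, then the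
  Jacobi identity trades it for brackets whose larger factor is smaller than \<open>t\<close>.\<close>

lemma commutator_hall:
  assumes A: "finite A"
  assumes "hall s" "hall t" "set (foliage s) \<subseteq> A" "set (foliage t) \<subseteq> A"
    "foliage s < foliage t" "length (foliage s) + length (foliage t) = k"
  shows "commutator (bracket_val g s) (bracket_val g t)
    \<in> bracket_span g {x \<in> hall_brackets A k. foliage x < foliage t} k"
  using assms(2-)
proof (induction k arbitrary: s t rule: less_induct)
  case (less k)
  note outer = less.IH
  \<comment> \<open>The lexicographic order on words is not well-founded, so the inner induction
    runs over the number of words of length at most \<open>k\<close> over \<open>A\<close> that
    precede \<open>foliage t\<close>.\<close>
  define f where "f t = card {c. set c \<subseteq> A \<and> length c \<le> k \<and> c < foliage t}" for t
  have f: "f x < f t"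
    if "foliage x < foliage t" "set (foliage x) \<subseteq> A" "length (foliage x) \<le> k" for x t
    unfolding f_def
  proof (rule psubset_card_mono)
    show "finite {c. set c \<subseteq> A \<and> length c \<le> k \<and> c < foliage t}"
      by (rule finite_subset[OF _ finite_lists_length_le[OF A, of k]]) auto
    show "{c. set c \<subseteq> A \<and> length c \<le> k \<and> c < foliage x} \<subset> {c. set c \<subseteq> A \<and> length c \<le> k \<and> c < foliage t}"
      using that by (auto simp: psubset_eq)
  qed
  from less.prems show ?case
  proof (induction t arbitrary: s rule: measure_induct_rule[where f = f])
    case (less t)
    define M where "M = bracket_span g {x \<in> hall_brackets A k. foliage x < foliage t} k"
    define Sp where "Sp j = {x \<in> hall_brackets A j. foliage x < foliage t}" for j
    have M: "M \<lhd> G" unfolding M_def by (rule bracket_span_normal) auto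
    have Sp: "Sp j \<subseteq> hall_brackets A j" for j by (auto simp: Sp_def)
    have val: "bracket_val g x \<in> lower_central G (length (foliage x))"
      if "hall x" "set (foliage x) \<subseteq> A" for x
      using that by (intro hall_bracket_val) (simp add: hall_brackets_def)
    note valG = val[THEN lower_central_sub_carrier[THEN subsetD]]
    \<comment> \<open>The inner induction hypothesis wants the factors in increasing order. The
      opposite order follows by inversion, and equal factors have trivial commutator.\<close>
    have sym: "commutator (bracket_val g x) (bracket_val g y) \<in> M"
      if x: "hall x" "set (foliage x) \<subseteq> A" "foliage x < foliage t"
        and y: "hall y" "set (foliage y) \<subseteq> A" "foliage y < foliage t"
        and k: "length (foliage x) + length (foliage y) = k" for x y
    proof -
      have lt: "commutator (bracket_val g x) (bracket_val g y) \<in> M"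
        if x: "hall x" "set (foliage x) \<subseteq> A" "foliage x < foliage t"
          and y: "hall y" "set (foliage y) \<subseteq> A" "foliage y < foliage t"
          and k: "length (foliage x) + length (foliage y) = k" and "foliage x < foliage y" for x y
      proof -
        have "bracket_span g {z \<in> hall_brackets A k. foliage z < foliage y} k \<subseteq> M"
          unfolding M_def using y by (intro bracket_span_mono) auto
        then show ?thesis using less.IH[of y x] f[of y t] that by auto
      qed
      consider "foliage x < foliage y" | "foliage y < foliage x" | "x = y"
        using hall_foliage_inject x y by (metis linorder_less_linear)
      then show ?thesis
      proof cases
        case 2
        then show ?thesis
          using lt[of y x] x y k valG by (intro normal_commutator_swap[OF M, of "bracket_val g y"]) auto
      next
        case 3
        then show ?thesis
          using valG x normal_imp_subgroup[OF M] by (simp add: commutator_self subgroup.one_closed)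
      qed (use lt x y k in blast)
    qed
    have span: "commutator (bracket_val g y) h \<in> M"
      if y: "hall y" "set (foliage y) \<subseteq> A" "foliage y < foliage t"
        and h: "h \<in> bracket_span g (Sp j) j" and k: "length (foliage y) + j = k" for y h j
    proof (rule commutator_bracket_span[OF Sp val[OF y(1,2)] M _ _ h])
      show "lower_central G (Suc (length (foliage y) + j)) \<subseteq> M"
        unfolding M_def k by (rule lower_central_Suc_subset_bracket_span)
      show "commutator (bracket_val g y) (bracket_val g x) \<in> M" if "x \<in> Sp j" for x
        using that sym y k by (auto simp: Sp_def hall_brackets_def)
    qed
    show ?case unfolding M_def[symmetric]
    proof (cases "hall (Br s t)")
      case True
      then have "Br s t \<in> {x \<in> hall_brackets A k. foliage x < foliage t}"
        using less.prems hall_foliage_append_less by (auto simp: hall_brackets_def)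
      then show "commutator (bracket_val g s) (bracket_val g t) \<in> M"
        using bracket_val_in_span[of "Br s t" _ g k] unfolding M_def by simp
    next
      case False
      \<comment> \<open>A leaf followed by a greater word always gives a Hall bracket, so
        \<open>s\<close> splits; what fails is the condition
        \<open>foliage t \<le> foliage v\<close>.\<close>
      then obtain u v where s: "s = Br u v"
        using less.prems(1,2,5) by (cases s) simp_all
      then have vt: "foliage v < foliage t"
        using False less.prems(1,2,5) by (simp add: not_le)
      have h: "hall u" "hall v" "foliage u < foliage v"
        using less.prems(1) s hall_Br_D by blast+
      have ut: "foliage u < foliage t" using order_less_trans[OF h(3) vt] .
      have A: "set (foliage u) \<subseteq> A" "set (foliage v) \<subseteq> A" using less.prems(3) s by auto
      have k: "length (foliage u) + (length (foliage v) + length (foliage t)) = k"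
        "length (foliage v) + (length (foliage u) + length (foliage t)) = k"
        using less.prems(6) s by auto
      note lp = length_foliage_pos[of u] length_foliage_pos[of v]
      let ?u = "bracket_val g u" and ?v = "bracket_val g v" and ?t = "bracket_val g t"
      have G: "?u \<in> carrier G" "?v \<in> carrier G" "?t \<in> carrier G"
        using valG h(1,2) A less.prems(2,4) by blast+
      let ?Nv = "bracket_span g (Sp (length (foliage v) + length (foliage t))) (length (foliage v) + length (foliage t))"
      let ?Nu = "bracket_span g (Sp (length (foliage u) + length (foliage t))) (length (foliage u) + length (foliage t))"
      note Nv = bracket_span_normal[OF Sp, of "length (foliage v) + length (foliage t)"]
      note Nu = bracket_span_normal[OF Sp, of "length (foliage u) + length (foliage t)"]
      \<comment> \<open>The brackets of \<open>v\<close> and of \<open>u\<close> with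
        \<open>t\<close> have smaller weight, so the outer induction expresses them by Hall brackets
        preceding \<open>t\<close>. Inverses are inserted to match the shape of the Hall-Witt
        identity.\<close>
      have "commutator ?v ?t \<in> ?Nv"
        unfolding Sp_def using k lp by (intro outer[OF _ h(2) less.prems(2) A(2) less.prems(4) vt]) linarith+
      then have v: "commutator (inv ?v) ?t \<in> ?Nv"
        using G by (intro normal_commutator_inv_left[OF Nv])
      have "commutator ?u ?t \<in> ?Nu"
        unfolding Sp_def using k lp by (intro outer[OF _ h(1) less.prems(2) A(1) less.prems(4) ut]) linarith+
      then have "commutator (inv ?u) ?t \<in> ?Nu"
        using G by (intro normal_commutator_inv_left[OF Nu])
      then have "commutator ?t (inv ?u) \<in> ?Nu"
        using G normal_commutator_swap[OF Nu, of "inv ?u" ?t] by simp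
      then have u: "commutator (inv ?t) (inv ?u) \<in> ?Nu"
        using G by (intro normal_commutator_inv_left[OF Nu]) auto
      have 1: "commutator (inv ?u) (commutator (inv ?v) ?t) \<in> M"
        using G span[OF h(1) A(1) ut v k(1)] by (intro normal_commutator_inv_left[OF M]) auto
      have 2: "commutator ?v (commutator (inv ?t) (inv ?u)) \<in> M"
        by (rule span[OF h(2) A(2) vt u k(2)])
      have "commutator ?t (commutator (inv (inv ?u)) ?v) \<in> M"
        by (rule normal_three_commutators[OF M _ G(2,3) 1 2]) (use G in simp)
      then show "commutator (bracket_val g s) (bracket_val g t) \<in> M"
        using G s normal_commutator_swap[OF M, of ?t "commutator ?u ?v"] by simp
    qed
  qed
qed

text \<open>Induction on \<open>k\<close>. Modulo Gamma_(k+2), a commutator [x, y] with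
  \<open>y\<close> in Gamma_k matters only up to Gamma_(k+1) in its second entry and may be tested
  on generators in its first. What remains is a letter against a Hall bracket of weight
  \<open>k\<close>, which \<open>commutator_hall\<close> treats after ordering the two.\<close>

theorem lower_central_eq_hall_span:
  assumes A: "finite A" and gen: "generate G (g ` A) = carrier G" and "k \<ge> 1"
  shows "lower_central G k = bracket_span g (hall_brackets A k) k"
proof (rule antisym[OF _ bracket_span_subset[OF subset_refl]])
  note N = bracket_span_normal[OF subset_refl]
  show "lower_central G k \<subseteq> bracket_span g (hall_brackets A k) k"
    using \<open>k \<ge> 1\<close>
  proof (induction k rule: nat_induct_at_least)
    case base
    have "Leaf i \<in> hall_brackets A 1" if "i \<in> A" for i
      using that by (simp add: hall_brackets_def)
    then have "g ` A \<subseteq> bracket_val g ` hall_brackets A 1"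
      by (metis bracket_val.simps(1) image_eqI image_subsetI)
    then have "generate G (g ` A) \<subseteq> bracket_span g (hall_brackets A 1) 1"
      unfolding bracket_span_def by (intro mono_generate) auto
    then show ?case using gen by simp
  next
    case (Suc k)
    let ?M = "bracket_span g (hall_brackets A (Suc k)) (Suc k)"
    have leaf: "commutator (g i) (bracket_val g t) \<in> ?M"
      if i: "i \<in> A" and t: "t \<in> hall_brackets A k" for i t
    proof -
      have tt: "hall t" "set (foliage t) \<subseteq> A" "length (foliage t) = k"
        using t by (auto simp: hall_brackets_def)
      have G: "g i \<in> carrier G" "bracket_val g t \<in> carrier G"
        using i g hall_bracket_val[OF t] lower_central_sub_carrier by auto
      have mono: "bracket_span g {x \<in> hall_brackets A (Suc k). P x} (Suc k) \<subseteq> ?M" for P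
        by (rule bracket_span_mono) auto
      consider "[i] < foliage t" | "foliage t < [i]" | "Leaf i = t"
        using hall_foliage_inject[of "Leaf i" t] tt by fastforce
      then show ?thesis
      proof cases
        case 1
        then show ?thesis using subsetD[OF mono commutator_hall[OF A, of "Leaf i" t "Suc k"]] i tt by simp
      next
        case 2
        then show ?thesis
          using subsetD[OF mono commutator_hall[OF A, of t "Leaf i" "Suc k"]] i tt
            normal_commutator_swap[OF N G(2,1)] by simp
      next
        case 3
        then show ?thesis
          using G(1) normal_imp_subgroup[OF N] by (auto simp: commutator_self subgroup.one_closed)
      qed
    qed
    have "commutator x y \<in> ?M" if x: "x \<in> carrier G" and y: "y \<in> lower_central G k" for x y
    proof (rule generate_commutator_mem[OF N g])
      show "x \<in> generate G (g ` A)" using gen x by simp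
      show yG: "y \<in> carrier G" using y lower_central_sub_carrier by blast
      fix s assume "s \<in> g ` A"
      then obtain i where i: "i \<in> A" "s = g i" by blast
      show "commutator s y \<in> ?M"
      proof (rule commutator_bracket_span[OF subset_refl _ N])
        show "s \<in> lower_central G 1" using i g by auto
        show "y \<in> bracket_span g (hall_brackets A k) k" using Suc.IH y by blast
        show "lower_central G (Suc (1 + k)) \<subseteq> ?M"
          using lower_central_Suc_subset_bracket_span[of "Suc k"] by simp
      qed (use leaf i in auto)
    qed
    then show ?case
      unfolding lower_central_Suc[OF \<open>1 \<le> k\<close>]
      by (intro generate_subgroup_incl normal_imp_subgroup[OF N]) auto
  qed
qed

end

end

section \<open>The Magnus expansion\<close>

text \<open>Integral power series in noncommuting variables X_i, given by their coefficients at
  words. A separate type carries the instance of \<open>ring_1\<close> with the Cauchy product as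
  multiplication.\<close>

typedef magnus = "UNIV :: (nat list \<Rightarrow> int) set"
  morphisms coeff Magnus by simp

lemma coeff_Magnus [simp]: "coeff (Magnus f) = f"
  by (simp add: Magnus_inverse)

lemma magnus_eqI: "(\<And>w. coeff f w = coeff g w) \<Longrightarrow> f = g"
  by (simp add: coeff_inject [symmetric] ext)

text \<open>The sum of \<open>f u * g v\<close> over all factorizations \<open>w = u @ v\<close>.
  The recursion splits off the empty \<open>u\<close> and absorbs the first letter of every other
  \<open>u\<close> into \<open>f\<close>.\<close>

primrec convolve :: "nat list \<Rightarrow> (nat list \<Rightarrow> int) \<Rightarrow> (nat list \<Rightarrow> int) \<Rightarrow> int" where
  "convolve [] f g = f [] * g []"
| "convolve (a # w) f g = f [] * g (a # w) + convolve w (\<lambda>u. f (a # u)) g"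

lemma convolve_add_left: "convolve w (\<lambda>u. f u + f' u) g = convolve w f g + convolve w f' g"
  by (induction w arbitrary: f f') (simp_all add: algebra_simps)

lemma convolve_add_right: "convolve w f (\<lambda>u. g u + g' u) = convolve w f g + convolve w f g'"
  by (induction w arbitrary: f) (simp_all add: algebra_simps)

lemma convolve_scale_left: "convolve w (\<lambda>u. c * f u) g = c * convolve w f g"
  by (induction w arbitrary: f) (simp_all add: algebra_simps)

lemma convolve_zero_left [simp]: "convolve w (\<lambda>u. 0) g = 0"
  by (induction w) simp_all

lemma convolve_assoc:
  "convolve w (\<lambda>u. convolve u f g) h = convolve w f (\<lambda>u. convolve u g h)"
  by (induction w arbitrary: f)
    (simp_all add: convolve_add_left convolve_scale_left algebra_simps)

lemma convolve_one_left: "convolve w (\<lambda>u. if u = [] then 1 else 0) g = g w"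
  by (cases w) auto

lemma convolve_one_right: "convolve w f (\<lambda>u. if u = [] then 1 else 0) = f w"
  by (induction w arbitrary: f) auto

instantiation magnus :: ring_1
begin

definition "0 = Magnus (\<lambda>w. 0)"
definition "1 = Magnus (\<lambda>w. if w = [] then 1 else 0)"
definition "f + g = Magnus (\<lambda>w. coeff f w + coeff g w)"
definition "f - g = Magnus (\<lambda>w. coeff f w - coeff g w)"
definition "- f = Magnus (\<lambda>w. - coeff f w)"
definition "f * g = Magnus (\<lambda>w. convolve w (coeff f) (coeff g))"

instance
proof
  show "(0::magnus) \<noteq> 1"
    by (auto simp: zero_magnus_def one_magnus_def Magnus_inject fun_eq_iff)
qed (auto intro!: magnus_eqI simp: zero_magnus_def one_magnus_def plus_magnus_def minus_magnus_def
    uminus_magnus_def times_magnus_def convolve_add_left convolve_add_right convolve_assoc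
    convolve_one_left convolve_one_right)

end

lemma coeff_simps [simp]:
  "coeff 0 w = 0"
  "coeff 1 w = (if w = [] then 1 else 0)"
  "coeff (f + g) w = coeff f w + coeff g w"
  "coeff (f - g) w = coeff f w - coeff g w"
  "coeff (- f) w = - coeff f w"
  by (simp_all add: zero_magnus_def one_magnus_def plus_magnus_def minus_magnus_def uminus_magnus_def)

lemma coeff_mult: "coeff (f * g) w = convolve w (coeff f) (coeff g)"
  by (simp add: times_magnus_def)

section \<open>Order and lowest terms of power series\<close>

definition order_ge :: "nat \<Rightarrow> magnus \<Rightarrow> bool" where
  "order_ge k f \<longleftrightarrow> (\<forall>w. length w < k \<longrightarrow> coeff f w = 0)"

text \<open>A factorization \<open>w = u @ v\<close> contributes only if \<open>u\<close> has length
  at least \<open>i\<close> and \<open>v\<close> length at least \<open>j\<close>; for words this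
  short that leaves at most one.\<close>

lemma convolve_leading:
  assumes "\<And>u. length u < i \<Longrightarrow> f u = 0" "\<And>u. length u < j \<Longrightarrow> g u = 0" "length w \<le> i + j"
  shows "convolve w f g = (if length w = i + j then f (take i w) * g (drop i w) else 0)"
  using assms
proof (induction w arbitrary: i f)
  case (Cons a w)
  show ?case
  proof (cases i)
    case 0
    then show ?thesis using Cons.IH[of 0 "\<lambda>u. f (a # u)"] Cons.prems by auto
  next
    case (Suc i')
    then show ?thesis using Cons.IH[of i' "\<lambda>u. f (a # u)"] Cons.prems by auto
  qed
qed auto

lemma coeff_mult_leading:
  assumes "order_ge i f" "order_ge j g" "length w = i + j"
  shows "coeff (f * g) w = coeff f (take i w) * coeff g (drop i w)"
  using convolve_leading[of i "coeff f" j "coeff g" w] assms by (simp add: order_ge_def coeff_mult)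

lemma order_ge_mult:
  assumes "order_ge i f" "order_ge j g"
  shows "order_ge (i + j) (f * g)"
  using convolve_leading[of i "coeff f" j "coeff g"] assms by (simp add: order_ge_def coeff_mult)

lemma order_ge_0 [simp]: "order_ge 0 f"
  by (simp add: order_ge_def)

lemma order_ge_add: "order_ge k f \<Longrightarrow> order_ge k g \<Longrightarrow> order_ge k (f + g)"
  by (simp add: order_ge_def)

lemma order_ge_diff: "order_ge k f \<Longrightarrow> order_ge k g \<Longrightarrow> order_ge k (f - g)"
  by (simp add: order_ge_def)

lemma order_ge_mult_right: "order_ge k f \<Longrightarrow> order_ge k (f * g)"
  using order_ge_mult[of k f 0 g] by simp

section \<open>The variables and the inverses of 1 + X_i\<close>

definition mvar :: "nat \<Rightarrow> magnus" where
  "mvar i = Magnus (\<lambda>w. if w = [i] then 1 else 0)"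

lemma coeff_mvar [simp]: "coeff (mvar i) w = (if w = [i] then 1 else 0)"
  by (simp add: mvar_def)

lemma coeff_mvar_mult:
  "coeff (mvar i * f) w = (if w \<noteq> [] \<and> hd w = i then coeff f (tl w) else 0)"
  by (cases w) (auto simp: coeff_mult convolve_one_left)

lemma coeff_mult_mvar:
  "coeff (f * mvar i) w = (if w \<noteq> [] \<and> last w = i then coeff f (butlast w) else 0)"
proof -
  have "convolve w h (\<lambda>u. if u = [i] then 1 else 0) = (if w \<noteq> [] \<and> last w = i then h (butlast w) else 0)" for h
    by (induction w arbitrary: h) auto
  moreover have "coeff (mvar i) = (\<lambda>u. if u = [i] then 1 else 0)" by auto
  ultimately show ?thesis by (simp add: coeff_mult)
qed

definition geometric :: "nat \<Rightarrow> magnus" where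
  "geometric i = Magnus (\<lambda>w. if set w \<subseteq> {i} then (- 1) ^ length w else 0)"

lemma coeff_geometric [simp]: "coeff (geometric i) w = (if set w \<subseteq> {i} then (- 1) ^ length w else 0)"
  by (simp add: geometric_def)

lemma geometric_inverse: "(1 + mvar i) * geometric i = 1" "geometric i * (1 + mvar i) = 1"
proof -
  have "coeff (geometric i + mvar i * geometric i) w = coeff 1 w" for w
    unfolding coeff_simps coeff_mvar_mult by (cases w) auto
  then show "(1 + mvar i) * geometric i = 1"
    by (auto intro!: magnus_eqI simp: distrib_right)
  have "coeff (geometric i + geometric i * mvar i) w = coeff 1 w" for w
    unfolding coeff_simps coeff_mult_mvar by (cases w rule: rev_cases) auto
  then show "geometric i * (1 + mvar i) = 1"
    by (auto intro!: magnus_eqI simp: distrib_left)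
qed

section \<open>The group of invertible series with constant term 1\<close>

definition magnus_units :: "magnus monoid" where
  "magnus_units = \<lparr>carrier = {u. order_ge 1 (u - 1) \<and> (\<exists>v. u * v = 1 \<and> v * u = 1)},
     monoid.mult = (*), one = 1\<rparr>"

lemma magnus_units_simps [simp]:
  "u \<otimes>\<^bsub>magnus_units\<^esub> v = u * v" "\<one>\<^bsub>magnus_units\<^esub> = 1"
  by (simp_all add: magnus_units_def)

lemma carrier_magnus_units:
  "u \<in> carrier magnus_units \<longleftrightarrow> coeff u [] = 1 \<and> (\<exists>v. u * v = 1 \<and> v * u = 1)"
  by (auto simp: magnus_units_def order_ge_def)

lemma coeff_mult_Nil: "coeff (u * v) [] = coeff u [] * coeff v []"
  by (simp add: coeff_mult)

lemma group_magnus_units: "group magnus_units"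
proof (rule groupI)
  fix u v assume "u \<in> carrier magnus_units" "v \<in> carrier magnus_units"
  then obtain u' v' where "u * u' = 1" "u' * u = 1" "v * v' = 1" "v' * v = 1" "coeff (u * v) [] = 1"
    by (auto simp: carrier_magnus_units coeff_mult_Nil)
  then have "(u * v) * (v' * u') = 1" "(v' * u') * (u * v) = 1"
    by (metis mult.assoc mult_1)+
  then show "u \<otimes>\<^bsub>magnus_units\<^esub> v \<in> carrier magnus_units"
    using \<open>coeff (u * v) [] = 1\<close> by (auto simp: carrier_magnus_units)
next
  fix u assume "u \<in> carrier magnus_units"
  then obtain v where u: "coeff u [] = 1" "u * v = 1" "v * u = 1"
    by (auto simp: carrier_magnus_units)
  then have "coeff v [] = 1" using coeff_mult_Nil[of u v] by simp
  then show "\<exists>v\<in>carrier magnus_units. v \<otimes>\<^bsub>magnus_units\<^esub> u = \<one>\<^bsub>magnus_units\<^esub>"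
    using u by (intro bexI[of _ v]) (auto simp: carrier_magnus_units)
qed (auto simp: carrier_magnus_units mult.assoc)

lemma one_plus_mvar_in_units: "1 + mvar i \<in> carrier magnus_units"
  using geometric_inverse[of i] by (auto simp: carrier_magnus_units)

section \<open>Leading parts under a homomorphism into the power series\<close>

locale magnus_hom = group_hom G magnus_units \<mu> for G (structure) and \<mu>
begin

lemma mu_inv: "x \<in> carrier G \<Longrightarrow> \<mu> x * \<mu> (inv x) = 1" "x \<in> carrier G \<Longrightarrow> \<mu> (inv x) * \<mu> x = 1"
  using hom_mult[of x "inv x"] hom_mult[of "inv x" x] hom_one by (simp_all del: hom_mult hom_inv)

text \<open>All coefficients are kept. For \<open>x\<close> in Gamma_k those at words of length
  \<open>k\<close> form its leading part.\<close>

definition lead :: "'a \<Rightarrow> nat list \<Rightarrow> int" where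
  "lead x = coeff (\<mu> x - 1)"

lemma order_ge_1: "x \<in> carrier G \<Longrightarrow> order_ge 1 (\<mu> x - 1)"
  using hom_closed[of x] by (simp add: magnus_units_def)

lemma mu_mult: "x \<in> carrier G \<Longrightarrow> y \<in> carrier G \<Longrightarrow> \<mu> (x \<otimes> y) - 1 = (\<mu> x - 1) * (\<mu> y - 1) + (\<mu> x - 1) + (\<mu> y - 1)"
  by (simp add: algebra_simps)

text \<open>XY - YX does not change when 1 is subtracted from both X and Y, and the last factor is
  the inverse of the image of \<open>y \<otimes> x\<close>.\<close>

lemma mu_commutator:
  assumes "x \<in> carrier G" "y \<in> carrier G"
  shows "\<mu> (G.commutator x y) - 1 =
    ((\<mu> x - 1) * (\<mu> y - 1) - (\<mu> y - 1) * (\<mu> x - 1)) * \<mu> (inv x \<otimes> inv y)"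
proof -
  have "((\<mu> x - 1) * (\<mu> y - 1) - (\<mu> y - 1) * (\<mu> x - 1)) * \<mu> (inv x \<otimes> inv y)
    = \<mu> (x \<otimes> y) * \<mu> (inv x \<otimes> inv y) - \<mu> (y \<otimes> x) * \<mu> (inv x \<otimes> inv y)"
    using assms by (simp add: algebra_simps)
  also have "\<mu> (x \<otimes> y) * \<mu> (inv x \<otimes> inv y) = \<mu> (G.commutator x y)"
    using assms by (simp add: G.commutator_def G.m_assoc mult.assoc)
  also have "\<mu> (y \<otimes> x) * \<mu> (inv x \<otimes> inv y) = \<mu> (y \<otimes> x \<otimes> (inv x \<otimes> inv y))"
    using assms by (simp only: hom_mult G.m_closed G.inv_closed magnus_units_simps)
  also have "y \<otimes> x \<otimes> (inv x \<otimes> inv y) = \<one>"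
    using assms by (simp add: G.word_simps)
  finally show ?thesis by simp
qed

lemma order_ge_commutator:
  assumes "x \<in> carrier G" "y \<in> carrier G" "order_ge i (\<mu> x - 1)" "order_ge j (\<mu> y - 1)"
  shows "order_ge (i + j) (\<mu> (G.commutator x y) - 1)"
  unfolding mu_commutator[OF assms(1,2)]
  using order_ge_mult[OF assms(3,4)] order_ge_mult[OF assms(4,3)]
  by (auto intro!: order_ge_mult_right order_ge_diff simp: add.commute)

text \<open>The last factor in \<open>mu_commutator\<close> has constant term 1 and leaves the
  lowest degree alone, so leading parts are combined by the Lie bracket.\<close>

lemma lead_commutator:
  assumes "x \<in> carrier G" "y \<in> carrier G" "order_ge i (\<mu> x - 1)" "order_ge j (\<mu> y - 1)"
    and w: "length w = i + j"
  shows "lead (G.commutator x y) w =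
    lead x (take i w) * lead y (drop i w) - lead y (take j w) * lead x (drop j w)"
proof -
  let ?d = "(\<mu> x - 1) * (\<mu> y - 1) - (\<mu> y - 1) * (\<mu> x - 1)"
  have d: "order_ge (i + j) ?d"
    using order_ge_mult[OF assms(3,4)] order_ge_mult[OF assms(4,3)]
    by (auto intro!: order_ge_diff simp: add.commute)
  have "coeff (\<mu> (inv x \<otimes> inv y)) [] = 1"
    using order_ge_1[of "inv x \<otimes> inv y"] assms by (simp add: order_ge_def del: hom_mult)
  then have "lead (G.commutator x y) w = coeff ?d w"
    unfolding lead_def mu_commutator[OF assms(1,2)]
    using coeff_mult_leading[OF d order_ge_0, of w "\<mu> (inv x \<otimes> inv y)"] w by (simp del: hom_mult)
  also have "\<dots> = lead x (take i w) * lead y (drop i w) - lead y (take j w) * lead x (drop j w)"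
    using coeff_mult_leading[OF assms(3,4), of w] coeff_mult_leading[OF assms(4,3), of w] w
    by (simp add: lead_def del: coeff_simps(2))
  finally show ?thesis .
qed

text \<open>Orders add up under commutators, and closeness to 1 of a given order is preserved by
  products and inverses.\<close>

lemma order_ge_lower_central:
  "k \<ge> 1 \<Longrightarrow> x \<in> lower_central G k \<Longrightarrow> order_ge k (\<mu> x - 1)"
proof (induction k arbitrary: x rule: nat_induct_at_least)
  case base
  then show ?case using order_ge_1 by simp
next
  case (Suc k)
  let ?S = "{G.commutator x y | x y. x \<in> carrier G \<and> y \<in> lower_central G k}"
  note sub = G.lower_central_sub_carrier[of k, THEN subsetD]
  have S: "s \<in> carrier G \<and> order_ge (Suc k) (\<mu> s - 1)" if "s \<in> ?S" for s
    using that Suc.IH order_ge_commutator[OF _ _ order_ge_1, of _ _ k] sub by auto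
  have "x \<in> generate G ?S" using Suc.prems G.lower_central_Suc[OF Suc.hyps] by simp
  then show ?case
  proof (induction rule: generate.induct)
    case one
    then show ?case by (simp add: order_ge_def)
  next
    case (incl h)
    then show ?case using S by blast
  next
    case (inv h)
    have "\<mu> (inv h) - 1 = (\<mu> h - 1) * (- \<mu> (inv h))"
      using S[OF inv.hyps] mu_inv(1)[of h] by (simp add: algebra_simps del: hom_inv)
    then show ?case using S[OF inv.hyps] order_ge_mult_right by metis
  next
    case (eng h1 h2)
    have "h1 \<in> carrier G" "h2 \<in> carrier G"
      using S G.generate_in_carrier[of ?S] eng.hyps by blast+
    note mu_mult[OF this]
    then show ?case
      using eng.IH by (simp only:) (intro order_ge_add order_ge_mult_right)
  qed
qed

text \<open>The cross term has order 2k, which exceeds \<open>k\<close>, so the degree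
  \<open>k\<close> part is additive on Gamma_k.\<close>

lemma lead_mult:
  assumes "x \<in> lower_central G k" "y \<in> lower_central G k" "k \<ge> 1" "length w = k"
  shows "lead (x \<otimes> y) w = lead x w + lead y w"
proof -
  have "order_ge k (\<mu> x - 1)" "order_ge k (\<mu> y - 1)"
    using assms order_ge_lower_central by auto
  then have "order_ge (k + k) ((\<mu> x - 1) * (\<mu> y - 1))" by (rule order_ge_mult)
  then have "coeff ((\<mu> x - 1) * (\<mu> y - 1)) w = 0"
    using assms by (simp add: order_ge_def del: coeff_simps)
  then show ?thesis
    using assms G.lower_central_sub_carrier[of k] unfolding lead_def
    by (subst mu_mult) (auto simp del: coeff_simps(2,4))
qed

end

section \<open>Faithfulness of the leading part\<close>

context magnus_hom
begin

lemma lead_one [simp]: "lead \<one> w = 0"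
  by (simp add: lead_def)

lemma lead_inv:
  assumes "x \<in> lower_central G k" "k \<ge> 1" "length w = k"
  shows "lead (inv x) w = - lead x w"
  using lead_mult[OF assms(1) subgroup.m_inv_closed[OF G.lower_central_subgroup assms(1)] assms(2,3)]
    assms(1) G.lower_central_sub_carrier[of k] by (simp add: subset_iff)

lemma lead_nat_pow:
  fixes e :: nat
  assumes "x \<in> lower_central G k" "k \<ge> 1" "length w = k"
  shows "x [^] e \<in> lower_central G k \<and> lead (x [^] e) w = int e * lead x w"
proof (induction e)
  case 0
  then show ?case using subgroup.one_closed[OF G.lower_central_subgroup] by simp
next
  case (Suc e)
  then show ?case
    using assms lead_mult[of "x [^] e" k x w] subgroup.m_closed[OF G.lower_central_subgroup, of "x [^] e" k x]
    by (simp add: algebra_simps)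
qed

lemma lead_int_pow:
  fixes e :: int
  assumes "x \<in> lower_central G k" "k \<ge> 1" "length w = k"
  shows "x [^] e \<in> lower_central G k \<and> lead (x [^] e) w = e * lead x w"
proof -
  have "x \<in> carrier G" using assms(1) G.lower_central_sub_carrier by blast
  then show ?thesis
    using lead_nat_pow[OF assms] lead_inv[OF _ assms(2,3)] subgroup.m_inv_closed[OF G.lower_central_subgroup]
    by (cases e rule: int_cases2) (auto simp: int_pow_int G.int_pow_neg_int)
qed

lemma lead_lower_central_Suc:
  assumes "x \<in> lower_central G (Suc k)" "length w = k"
  shows "lead x w = 0"
  using order_ge_lower_central[OF _ assms(1)] assms(2) by (simp add: order_ge_def lead_def del: coeff_simps)

section \<open>Leading parts of brackets in generators sent to 1 + X_i\<close>

context
  fixes g :: "nat \<Rightarrow> 'a" and A :: "nat set"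
  assumes g: "g ` A \<subseteq> carrier G" and mu_g: "\<And>i. i \<in> A \<Longrightarrow> \<mu> (g i) = 1 + mvar i"
begin

lemma lead_bracket_val:
  "set (foliage t) \<subseteq> A \<Longrightarrow> length w = length (foliage t) \<Longrightarrow> lead (G.bracket_val g t) w = lie_coeff t w"
proof (induction t arbitrary: w)
  case (Leaf i)
  then show ?case by (simp add: lead_def mu_g)
next
  case (Br s t)
  have "order_ge (length (foliage r)) (\<mu> (G.bracket_val g r) - 1) \<and> G.bracket_val g r \<in> carrier G"
    if "set (foliage r) \<subseteq> A" for r
    using order_ge_lower_central[OF _ G.bracket_val_lower_central[of g r]] that g
      G.bracket_val_lower_central[of g r] G.lower_central_sub_carrier length_foliage_pos[of r]
    by (metis One_nat_def Suc_leI image_mono order_trans subsetD)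
  then show ?case
    using Br lead_commutator[of "G.bracket_val g s" "G.bracket_val g t" "length (foliage s)" "length (foliage t)" w]
    by simp
qed

text \<open>The coefficient at \<open>w\<close> is additive on Gamma_k and vanishes on Gamma_(k+1),
  so the brackets in \<open>S\<close> decide.\<close>

lemma lead_bracket_span_eq_0:
  assumes "x \<in> G.bracket_span g S k" and S: "S \<subseteq> hall_brackets A k" and k: "k \<ge> 1" "length w = k"
    and 0: "\<And>t. t \<in> S \<Longrightarrow> lie_coeff t w = 0"
  shows "lead x w = 0"
proof -
  let ?T = "G.bracket_val g ` S \<union> lower_central G (Suc k)"
  have T: "s \<in> lower_central G k \<and> lead s w = 0" if "s \<in> ?T" for s
    using that
  proof
    assume "s \<in> G.bracket_val g ` S"
    then obtain t where t: "t \<in> S" "s = G.bracket_val g t" by blast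
    then have h: "t \<in> hall_brackets A k" using S by blast
    then show ?thesis
      using t 0 G.hall_bracket_val[OF g h] lead_bracket_val[of t w] k by (simp add: hall_brackets_def)
  next
    assume "s \<in> lower_central G (Suc k)"
    then show ?thesis using lead_lower_central_Suc k G.lower_central_le_Suc by blast
  qed
  have "x \<in> generate G ?T" using assms(1) by (simp add: G.bracket_span_def)
  then have "x \<in> lower_central G k \<and> lead x w = 0"
  proof (induction rule: generate.induct)
    case (inv h)
    then show ?case
      using T[OF inv] lead_inv[OF _ k, of h] subgroup.m_inv_closed[OF G.lower_central_subgroup] by simp
  next
    case (eng h1 h2)
    then show ?case
      using lead_mult[OF _ _ k, of h1 h2] subgroup.m_closed[OF G.lower_central_subgroup] by simp
  qed (use T subgroup.one_closed[OF G.lower_central_subgroup] in auto)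
  then show ?thesis by simp
qed

text \<open>The coefficient of the bracket with the least foliage is the coefficient of that foliage,
  so the brackets can be peeled off one after the other.\<close>

lemma bracket_span_lead_faithful:
  assumes "finite S" "S \<subseteq> hall_brackets A k" "k \<ge> 1"
    "x \<in> G.bracket_span g S k" "\<And>w. length w = k \<Longrightarrow> lead x w = 0"
  shows "x \<in> lower_central G (Suc k)"
  using assms(1,2,4)
proof (induction S rule: finite_remove_induct)
  case empty
  then show ?case
    using G.generate_subgroup_incl[OF subset_refl G.lower_central_subgroup, of "Suc k"]
    by (auto simp: G.bracket_span_def)
next
  case (remove S)
  have "Min (foliage ` S) \<in> foliage ` S" using remove.hyps by (intro Min_in) auto
  then obtain t where t: "t \<in> S" "foliage t = Min (foliage ` S)" by auto
  then have least: "foliage t \<le> foliage s" if "s \<in> S" for s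
    using that remove.hyps by simp
  let ?N = "G.bracket_span g (S - {t}) k" and ?v = "G.bracket_val g t"
  have tA: "t \<in> hall_brackets A k" using t remove.prems by blast
  have v: "?v \<in> lower_central G k" using G.hall_bracket_val[OF g tA] .
  then have vG: "?v \<in> carrier G" using G.lower_central_sub_carrier by blast
  have S': "S - {t} \<subseteq> hall_brackets A k" using remove.prems by blast
  have N: "?N \<lhd> G" by (rule G.bracket_span_normal[OF g S'])
  have NG: "?N \<subseteq> carrier G" using subgroup.subset[OF normal_imp_subgroup[OF N]] .
  have C: "subgroup (generate G {?v}) G" using vG by (intro G.generate_is_subgroup) auto
  \<comment> \<open>As \<open>?N\<close> is normal, its products with powers of \<open>?v\<close>
    form a subgroup; thus every element of the span is \<open>h\<close> times a power of
    \<open>?v\<close> with \<open>h\<close> in \<open>?N\<close>.\<close>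
  have "G.bracket_span g S k \<subseteq> ?N <#> generate G {?v}"
    unfolding G.bracket_span_def[of g S]
  proof (rule G.generate_subgroup_incl[OF _ G.mult_norm_subgroup[OF N C]])
    have "?N \<subseteq> ?N <#> generate G {?v}"
    proof
      fix y assume y: "y \<in> ?N"
      then have "y = y \<otimes> \<one>" using NG by auto
      then show "y \<in> ?N <#> generate G {?v}"
        using y generate.one[of G "{?v}"] unfolding set_mult_def by blast
    qed
    moreover have "?v \<in> ?N <#> generate G {?v}"
    proof -
      have "?v = \<one> \<otimes> ?v" using vG by simp
      moreover have "\<one> \<in> ?N" using subgroup.one_closed[OF normal_imp_subgroup[OF N]] .
      ultimately show ?thesis
        using generate.incl[of ?v "{?v}" G] unfolding set_mult_def by blast
    qed
    moreover have "G.bracket_val g s \<in> ?N" if "s \<in> S" "s \<noteq> t" for s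
      using that by (intro G.bracket_val_in_span) auto
    ultimately show "G.bracket_val g ` S \<union> lower_central G (Suc k) \<subseteq> ?N <#> generate G {?v}"
      using G.lower_central_Suc_subset_bracket_span[of k g "S - {t}"] by blast
  qed
  then obtain h c where hc: "h \<in> ?N" "c \<in> generate G {?v}" "x = h \<otimes> c"
    using remove.prems(2) unfolding set_mult_def by blast
  then obtain e :: int where e: "c = ?v [^] e"
    using G.generate_pow[OF vG] by blast
  have len: "length (foliage t) = k" and hall: "hall t" using tA by (auto simp: hall_brackets_def)
  \<comment> \<open>By triangularity a nonzero coefficient would make \<open>foliage s\<close> at
    most \<open>foliage t\<close>, hence equal to it by minimality.\<close>
  have "lie_coeff s (foliage t) = 0" if "s \<in> S - {t}" for s
  proof (rule ccontr)
    assume "lie_coeff s (foliage t) \<noteq> 0"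
    moreover have "hall s" "length (foliage s) = k" using that S' by (auto simp: hall_brackets_def)
    ultimately have "foliage s \<le> foliage t" using lie_coeff_hall(2) len by metis
    then have "foliage s = foliage t" using least[of s] that by auto
    then show False using hall_foliage_inject[of s t] \<open>hall s\<close> hall that by blast
  qed
  then have "lead h (foliage t) = 0"
    using lead_bracket_span_eq_0[OF hc(1) S' \<open>k \<ge> 1\<close> len] by blast
  moreover have "lead ?v (foliage t) = 1"
    using lead_bracket_val[of t "foliage t"] lie_coeff_hall(1)[OF hall] tA by (simp add: hall_brackets_def)
  moreover have "h \<in> lower_central G k" using hc(1) G.bracket_span_subset[OF g S'] by blast
  moreover note lead_int_pow[OF v \<open>k \<ge> 1\<close> len, of e]
  ultimately have "lead x (foliage t) = e"
    using lead_mult[of h k "?v [^] e", OF _ _ \<open>k \<ge> 1\<close> len] e hc(3) by simp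
  then have "e = 0" using assms(5)[OF len] by simp
  then have "x \<in> ?N" using hc e NG by auto
  then show ?case using remove.IH[OF t(1)] S' by blast
qed

text \<open>Hall brackets span Gamma_k modulo Gamma_(k+1), and there are finitely many of them over
  a finite alphabet.\<close>

theorem lead_faithful:
  assumes "finite A" "generate G (g ` A) = carrier G" "k \<ge> 1" "x \<in> lower_central G k"
    "\<And>w. length w = k \<Longrightarrow> lead x w = 0"
  shows "x \<in> lower_central G (Suc k)"
  using assms G.lower_central_eq_hall_span[OF g, of k] finite_hall_brackets[of A k]
  by (intro bracket_span_lead_faithful[of "hall_brackets A k"]) auto

text \<open>If \<open>U\<close> is the leading part of \<open>y\<close>, then \<open>U X\<^sub>i = X\<^sub>i U\<close>; reading off the coefficient of \<open>w @ [i]\<close>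
  shows that the words occurring in \<open>U\<close> start with \<open>i\<close>.\<close>

lemma lead_commuting_generator:
  assumes i: "i \<in> A" and k: "k \<ge> 1" and y: "y \<in> lower_central G k"
    and c: "G.commutator y (g i) \<in> lower_central G (Suc (Suc k))"
    and w: "length w = k" "hd w \<noteq> i"
  shows "lead y w = 0"
proof -
  have gi: "g i \<in> carrier G" using i g by blast
  have "lead (G.commutator y (g i)) (w @ [i]) = 0"
    using lead_lower_central_Suc[OF c, of "w @ [i]"] w by simp
  \<comment> \<open>The subtracted product starts with the letter \<open>i\<close>, which
    \<open>w @ [i]\<close> does not.\<close>
  moreover have "lead (G.commutator y (g i)) (w @ [i]) = lead y w"
    using lead_commutator[OF _ gi order_ge_lower_central[OF k y] order_ge_1[OF gi], of "w @ [i]"]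
      w k y G.lower_central_sub_carrier[of k] mu_g[OF i]
    by (cases w) (auto simp: lead_def subset_iff)
  ultimately show ?thesis by simp
qed

end

end

section \<open>Displacements and centralizers in the free group\<close>

context group
begin

lemma displacement_mult:
  assumes "\<phi> \<in> hom G G" "M \<lhd> G" "g \<in> carrier G" "h \<in> carrier G"
    "\<phi> g \<otimes> inv g \<in> M" "\<phi> h \<otimes> inv h \<in> M"
  shows "\<phi> (g \<otimes> h) \<otimes> inv (g \<otimes> h) \<in> M"
proof -
  have c: "\<phi> g \<in> carrier G" "\<phi> h \<in> carrier G" using assms by (auto simp: hom_def)
  have "\<phi> (g \<otimes> h) \<otimes> inv (g \<otimes> h) =
      (\<phi> g \<otimes> (\<phi> h \<otimes> inv h) \<otimes> inv (\<phi> g)) \<otimes> (\<phi> g \<otimes> inv g)"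
    using assms c by (simp add: hom_mult word_simps)
  also have "\<dots> \<in> M"
    by (rule subgroup.m_closed[OF normal_imp_subgroup[OF assms(2)] normal_conj_mem[OF assms(2) c(1) assms(6)] assms(5)])
  finally show ?thesis .
qed

lemma displacement_inv:
  assumes "\<phi> \<in> hom G G" "M \<lhd> G" "g \<in> carrier G" "\<phi> g \<otimes> inv g \<in> M"
  shows "\<phi> (inv g) \<otimes> inv (inv g) \<in> M"
proof -
  interpret \<phi>: group_hom G G \<phi> using assms by (simp add: group_hom_def group_hom_axioms_def)
  have "\<phi> (inv g) \<otimes> inv (inv g) = inv (\<phi> g) \<otimes> inv (\<phi> g \<otimes> inv g) \<otimes> inv (inv (\<phi> g))"
    using assms by (simp add: word_simps)
  also have "\<dots> \<in> M"
    by (rule normal_conj_mem[OF assms(2) _ subgroup.m_inv_closed[OF normal_imp_subgroup[OF assms(2)] assms(4)]])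
      (use assms in simp)
  finally show ?thesis .
qed

text \<open>The elements that \<open>\<phi>\<close> fixes modulo the normal subgroup
  \<open>M\<close> form a subgroup.\<close>

lemma displacement_generate:
  assumes "\<phi> \<in> hom G G" "M \<lhd> G" "S \<subseteq> carrier G" "\<And>s. s \<in> S \<Longrightarrow> \<phi> s \<otimes> inv s \<in> M"
    and "h \<in> generate G S"
  shows "\<phi> h \<otimes> inv h \<in> M"
  using assms(5)
proof (induction rule: generate.induct)
  case one
  then show ?case
    using hom_one[OF assms(1)] subgroup.one_closed[OF normal_imp_subgroup[OF assms(2)]] by simp
next
  case (inv h)
  then show ?case using displacement_inv[OF assms(1,2)] assms(3,4) by blast
next
  case (eng h1 h2)
  then show ?case
    using displacement_mult[OF assms(1,2)] generate_in_carrier[OF assms(3)] by blast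
qed (use assms in auto)

text \<open>To be read with \<open>\<phi> x = u \<otimes> x\<close> and
  \<open>\<phi> a = v \<otimes> a\<close>. Each factor on the right is, up to conjugation, a
  commutator involving \<open>u\<close> or \<open>v\<close>, and so lies deep enough for
  \<open>displacement_lower_central\<close>.\<close>

lemma commutator_displacement:
  assumes "u \<in> carrier G" "x \<in> carrier G" "v \<in> carrier G" "a \<in> carrier G"
  shows "commutator (u \<otimes> x) (v \<otimes> a) \<otimes> inv (commutator x a) =
    commutator u (commutator x (v \<otimes> a)) \<otimes>
    (commutator x (v \<otimes> a) \<otimes> commutator u (v \<otimes> a) \<otimes> inv (commutator x (v \<otimes> a))) \<otimes>
    (commutator x v \<otimes> commutator v (commutator x a))"
  using assms by (simp add: commutator_def word_simps)

text \<open>This makes IA_n the first term of the Andreadakis filtration: acting trivially on the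
  abelianization forces trivial action on every Gamma_i/Gamma_(i+1), by induction over generating
  commutators.\<close>

lemma displacement_lower_central:
  assumes \<phi>: "\<phi> \<in> hom G G" and 2: "\<And>g. g \<in> carrier G \<Longrightarrow> \<phi> g \<otimes> inv g \<in> lower_central G (Suc 1)"
    and "i \<ge> 1" "g \<in> lower_central G i"
  shows "\<phi> g \<otimes> inv g \<in> lower_central G (Suc i)"
  using assms(3,4)
proof (induction i arbitrary: g rule: nat_induct_at_least)
  case base
  then show ?case using 2 by simp
next
  case (Suc i)
  interpret \<phi>: group_hom G G \<phi> using \<phi> by (simp add: group_hom_def group_hom_axioms_def)
  note N = lower_central_normal[of "Suc (Suc i)"]
  note NS = normal_imp_subgroup[OF N]
  let ?S = "{commutator x y | x y. x \<in> carrier G \<and> y \<in> lower_central G i}"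
  note sub = lower_central_sub_carrier[THEN subsetD]
  show ?case
  proof (rule displacement_generate[OF \<phi> N])
    show "?S \<subseteq> carrier G" using sub by blast
    show "g \<in> generate G ?S" using Suc.prems lower_central_Suc[OF Suc.hyps] by simp
    fix s assume "s \<in> ?S"
    then obtain x a where s: "s = commutator x a" and x: "x \<in> carrier G" and a: "a \<in> lower_central G i"
      by blast
    define u v where "u = \<phi> x \<otimes> inv x" and "v = \<phi> a \<otimes> inv a"
    have aG: "a \<in> carrier G" using a sub by blast
    have u: "u \<in> lower_central G (Suc 1)" and v: "v \<in> lower_central G (Suc i)"
      unfolding u_def v_def using 2[OF x] Suc.IH[OF a] .
    then have uv: "u \<in> carrier G" "v \<in> carrier G" using sub by blast+
    have e: "\<phi> x = u \<otimes> x" "\<phi> a = v \<otimes> a"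
      unfolding u_def v_def using x aG by (simp_all add: word_simps)
    have xa: "commutator x a \<in> lower_central G (Suc i)" "commutator x (v \<otimes> a) \<in> lower_central G (Suc i)"
      "v \<otimes> a \<in> lower_central G i"
    proof -
      show va: "v \<otimes> a \<in> lower_central G i"
        using v a lower_central_le_Suc by (intro subgroup.m_closed[OF lower_central_subgroup]) auto
      show "commutator x a \<in> lower_central G (Suc i)" "commutator x (v \<otimes> a) \<in> lower_central G (Suc i)"
        using x a va by (auto intro: commutator_lower_central_Suc)
    qed
    have m1: "commutator u (commutator x (v \<otimes> a)) \<in> lower_central G (Suc (Suc i))"
      by (rule commutator_lower_central_Suc[OF uv(1) xa(2)])
    have m2: "commutator u (v \<otimes> a) \<in> lower_central G (Suc (Suc i))"
      using commutator_lower_central[OF u xa(3)] by simp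
    have m3: "commutator x v \<in> lower_central G (Suc (Suc i))"
      by (rule commutator_lower_central_Suc[OF x v])
    have m4: "commutator v (commutator x a) \<in> lower_central G (Suc (Suc i))"
      by (rule commutator_lower_central_Suc[OF uv(2) xa(1)])
    have "\<phi> s = commutator (\<phi> x) (\<phi> a)"
      using s x aG by (simp add: commutator_def)
    then have "\<phi> s \<otimes> inv s = commutator (u \<otimes> x) (v \<otimes> a) \<otimes> inv (commutator x a)"
      using s e by simp
    also have "\<dots> \<in> lower_central G (Suc (Suc i))"
      unfolding commutator_displacement[OF uv(1) x uv(2) aG]
      using x uv aG by (intro subgroup.m_closed[OF NS] m1 m3 m4 normal_conj_mem[OF N _ m2]) auto
    finally show "\<phi> s \<otimes> inv s \<in> lower_central G (Suc (Suc i))" .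
  qed
qed

end

lemma derived_eq_lower_central: "derived G (carrier G) = lower_central G (Suc 1)"
  unfolding derived_def commutator_subgroup_def lower_central.simps One_nat_def
  by (rule arg_cong[of _ _ "generate G"]) auto

section \<open>The Magnus expansion of the free group and centralizers\<close>

lemma generate_gen: "generate (free_group n) (gen ` {1..n}) = carrier (free_group n)"
proof (rule antisym)
  interpret F: group "free_group n" by (rule group_free_group)
  have gens: "gen ` {1..n} \<subseteq> carrier (free_group n)" using gen_in_carrier by blast
  show "generate (free_group n) (gen ` {1..n}) \<subseteq> carrier (free_group n)"
    using gens by (rule F.generate_incl)
  have "w \<in> generate (free_group n) (gen ` {1..n})" if "w \<in> carrier (free_group n)" for w
    using that
  proof (induction w)
    case Nil
    then show ?case using generate.one[of "free_group n"] by (simp add: free_group_def)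
  next
    case (Cons a w)
    then have w: "w \<in> carrier (free_group n)" and a: "fst a \<in> {1..n}" and r: "reduced (a # w)"
      by (auto simp: free_group_def reduced_def successively_Cons)
    have "[a] = gen (fst a) \<or> [a] = inv\<^bsub>free_group n\<^esub> (gen (fst a))"
      using a inv_gen[of "fst a" n] by (cases "snd a") (auto simp: gen_def prod_eq_iff)
    then have "[a] \<in> generate (free_group n) (gen ` {1..n})"
      using a generate.incl[of "gen (fst a)" "gen ` {1..n}"] generate.inv[of "gen (fst a)" "gen ` {1..n}"]
      by auto
    moreover have "a # w = [a] \<otimes>\<^bsub>free_group n\<^esub> w"
      using r by (cases w) (auto simp: free_group_def reduced_def)
    ultimately show ?case using generate.eng[OF _ Cons.IH[OF w]] by metis
  qed
  then show "carrier (free_group n) \<subseteq> generate (free_group n) (gen ` {1..n})" by blast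
qed

lemma hom_eq_on_generate:
  assumes "group G" "group H" "f \<in> hom G H" "f' \<in> hom G H" "S \<subseteq> carrier G"
    "\<And>s. s \<in> S \<Longrightarrow> f s = f' s" "x \<in> generate G S"
  shows "f x = f' x"
proof -
  interpret f: group_hom G H f using assms by (simp add: group_hom_def group_hom_axioms_def)
  interpret f': group_hom G H f' using assms by (simp add: group_hom_def group_hom_axioms_def)
  show ?thesis using assms(7)
  proof (induction rule: generate.induct)
    case (inv h)
    then show ?case using assms by (simp add: subset_iff)
  next
    case (eng h1 h2)
    then show ?case using f.G.generate_in_carrier[OF assms(5)] by simp
  qed (use assms in auto)
qed

text \<open>If \<open>i\<close> occurs in \<open>u @ v\<close>, it occurs in \<open>u\<close> or in
  \<open>v\<close>; so series not involving X_i are closed under products.\<close>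

lemma convolve_support:
  assumes "\<And>u. i \<in> set u \<Longrightarrow> f u = 0" "\<And>u. i \<in> set u \<Longrightarrow> g u = 0" "i \<in> set w"
  shows "convolve w f g = 0"
  using assms
proof (induction w arbitrary: f)
  case (Cons a w)
  have "convolve w (\<lambda>u. f (a # u)) g = 0"
  proof (cases "a = i")
    case True
    then have "(\<lambda>u. f (a # u)) = (\<lambda>u. 0)" using Cons.prems by auto
    then show ?thesis by (simp del: fun_eq_iff)
  qed (use Cons in auto)
  then show ?case using Cons.prems by simp
qed simp

lemma magnus_expansion_exists:
  obtains \<mu> where "\<mu> \<in> hom (free_group n) magnus_units"
    "\<And>i. i \<in> {1..n} \<Longrightarrow> \<mu> (gen i) = 1 + mvar i"
  using ex1_implies_ex[OF free_group_universal[OF group_magnus_units one_plus_mvar_in_units,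
        of n "\<lambda>i. i"]] by (elim exE conjE IntE) blast

text \<open>In the graded Lie ring of \<open>F\<^sub>n\<close> the centralizer of \<open>x\<^sub>i\<close> consists of the multiples of \<open>x\<^sub>i\<close>; the
  alternative excludes these.\<close>

lemma lower_central_if_commutes:
  assumes w: "w \<in> carrier (free_group n)" and i: "i \<in> {1..n}"
    and ci: "group.commutator (free_group n) w (gen i) \<in> lower_central (free_group n) (Suc j)"
    and alt: "w \<in> generate (free_group n) (gen ` ({1..n} - {i})) \<or>
      (\<exists>l\<in>{1..n} - {i}. group.commutator (free_group n) w (gen l) \<in> lower_central (free_group n) (Suc j))"
  shows "w \<in> lower_central (free_group n) j"
proof -
  obtain \<mu> where \<mu>: "\<mu> \<in> hom (free_group n) magnus_units" and
    \<mu>g: "\<And>i. i \<in> {1..n} \<Longrightarrow> \<mu> (gen i) = 1 + mvar i" using magnus_expansion_exists by metis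
  interpret m: magnus_hom "free_group n" \<mu>
    using \<mu> group_free_group group_magnus_units
    by (simp add: magnus_hom_def group_hom_def group_hom_axioms_def)
  have gens: "gen ` {1..n} \<subseteq> carrier (free_group n)" using gen_in_carrier by blast
  \<comment> \<open>For \<open>l\<close> other than \<open>i\<close>, neither 1 + X_l nor its
    inverse, a geometric series in X_l, involves X_i.\<close>
  have supp: "coeff (\<mu> y) v = 0"
    if "y \<in> generate (free_group n) (gen ` ({1..n} - {i}))" "i \<in> set v" for y v
    using that
  proof (induction arbitrary: v rule: generate.induct)
    case one
    then show ?case by auto
  next
    case (incl h)
    then show ?case using \<mu>g by (auto split: if_splits)
  next
    case (inv h)
    then obtain l where l: "h = gen l" "l \<in> {1..n}" "l \<noteq> i" by blast
    have "\<mu> (inv\<^bsub>free_group n\<^esub> h) = geometric l * (\<mu> h * \<mu> (inv\<^bsub>free_group n\<^esub> h))"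
      using l \<mu>g geometric_inverse(2)[of l] by (simp del: m.hom_inv add: mult.assoc[symmetric])
    also have "\<dots> = geometric l" using m.mu_inv(1)[of h] l gen_in_carrier by simp
    finally show ?case using inv.prems l by auto
  next
    case (eng h1 h2)
    have "gen ` ({1..n} - {i}) \<subseteq> carrier (free_group n)" using gens by blast
    then have "h1 \<in> carrier (free_group n)" "h2 \<in> carrier (free_group n)"
      using eng.hyps m.G.generate_in_carrier by blast+
    then show ?case using eng by (simp add: coeff_mult convolve_support[of i])
  qed
  \<comment> \<open>Climb the series one step at a time: the leading part in degree \<open>k\<close>
    is shown to vanish, and faithfulness then gives membership in Gamma_(k+1).\<close>
  have "k \<le> j \<Longrightarrow> w \<in> lower_central (free_group n) k" for k
  proof (induction k)
    case (Suc k)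
    show ?case
    proof (cases "k \<ge> 1")
      case True
      have wk: "w \<in> lower_central (free_group n) k" using Suc by simp
      \<comment> \<open>Since k + 1 is at most \<open>j\<close>, the commutators lie in Gamma_(k+2),
        one step deeper than expected for \<open>w\<close> in Gamma_k, so the Lie bracket of the
        leading parts is zero.\<close>
      have le: "lower_central (free_group n) (Suc j) \<subseteq> lower_central (free_group n) (Suc (Suc k))"
        using Suc.prems by (intro m.G.lower_central_antimono) simp
      have "m.lead w v = 0" if v: "length v = k" for v
      \<comment> \<open>Commuting with x_i excludes words not starting with \<open>i\<close>. Words
        starting with \<open>i\<close> are excluded because \<open>w\<close> avoids x_i, or because
        commuting with x_l would make them start with \<open>l\<close>.\<close>
      proof (cases "hd v = i")
        case False
        then show ?thesis
          using m.lead_commuting_generator[OF gens \<mu>g i True wk _ v] ci le by blast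
      next
        case hd: True
        from alt show ?thesis
        proof
          assume "w \<in> generate (free_group n) (gen ` ({1..n} - {i}))"
          moreover have "v \<noteq> []" "i \<in> set v" using v True hd by (auto intro: hd_in_set)
          ultimately show ?thesis using supp by (simp add: m.lead_def)
        next
          assume "\<exists>l\<in>{1..n} - {i}. m.G.commutator w (gen l) \<in> lower_central (free_group n) (Suc j)"
          then show ?thesis
            using m.lead_commuting_generator[OF gens \<mu>g _ True wk _ v] le hd by blast
        qed
      qed
      then show ?thesis
        using m.lead_faithful[OF gens \<mu>g _ generate_gen True wk] by blast
    qed (use w in \<open>auto simp: not_le\<close>)
  qed (use w in simp)
  then show ?thesis by simp
qed

section \<open>The filtration of \<open>IA\<^sub>n\<close> and the partial inner automorphism group\<close>

context
  fixes n :: nat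
begin

interpretation F: group "free_group n" by (rule group_free_group)
interpretation A: group "AutoGroup (free_group n)" by (rule F.AutoGroup)

abbreviation "Fn \<equiv> free_group n"
abbreviation "Aut \<equiv> AutoGroup (free_group n)"

section \<open>Computing with automorphisms of the free group\<close>

lemma carrier_Aut [simp]: "carrier Aut = auto Fn"
  by (simp add: AutoGroup_def)

lemma auto_hom: "\<phi> \<in> auto Fn \<Longrightarrow> \<phi> \<in> hom Fn Fn"
  by (simp add: auto_def)

lemma auto_closed: "\<phi> \<in> auto Fn \<Longrightarrow> x \<in> carrier Fn \<Longrightarrow> \<phi> x \<in> carrier Fn"
  using auto_hom by (auto simp: hom_def)

lemma auto_group_hom: "\<phi> \<in> auto Fn \<Longrightarrow> group_hom Fn Fn \<phi>"
  by (simp add: group_hom_def group_hom_axioms_def auto_hom F.group_axioms)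

lemma auto_extensional: "\<phi> \<in> auto Fn \<Longrightarrow> \<phi> \<in> extensional (carrier Fn)"
  by (simp add: auto_def Bij_def)

lemma Aut_mult_apply:
  "\<phi> \<in> auto Fn \<Longrightarrow> \<psi> \<in> auto Fn \<Longrightarrow> x \<in> carrier Fn \<Longrightarrow> (\<phi> \<otimes>\<^bsub>Aut\<^esub> \<psi>) x = \<phi> (\<psi> x)"
  by (simp add: mult_AutoGroup compose_eq)

lemma Aut_one_apply: "x \<in> carrier Fn \<Longrightarrow> \<one>\<^bsub>Aut\<^esub> x = x"
  by (simp add: AutoGroup_def BijGroup_def)

lemma Aut_closed:
  "\<phi> \<in> auto Fn \<Longrightarrow> \<psi> \<in> auto Fn \<Longrightarrow> \<phi> \<otimes>\<^bsub>Aut\<^esub> \<psi> \<in> auto Fn"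
  "\<phi> \<in> auto Fn \<Longrightarrow> inv\<^bsub>Aut\<^esub> \<phi> \<in> auto Fn" "\<one>\<^bsub>Aut\<^esub> \<in> auto Fn"
  using A.m_closed A.inv_closed A.one_closed by simp_all

lemma Aut_inv_apply:
  assumes "\<phi> \<in> auto Fn" "x \<in> carrier Fn"
  shows "\<phi> ((inv\<^bsub>Aut\<^esub> \<phi>) x) = x" "(inv\<^bsub>Aut\<^esub> \<phi>) (\<phi> x) = x"
  using assms Aut_closed A.r_inv[of \<phi>] A.l_inv[of \<phi>] Aut_mult_apply Aut_one_apply
  by (metis carrier_Aut)+

lemma auto_eqI:
  assumes "\<phi> \<in> auto Fn" "\<psi> \<in> auto Fn" "\<And>i. i \<in> {1..n} \<Longrightarrow> \<phi> (gen i) = \<psi> (gen i)"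
  shows "\<phi> = \<psi>"
proof (rule extensionalityI[OF auto_extensional[OF assms(1)] auto_extensional[OF assms(2)]])
  fix x assume "x \<in> carrier Fn"
  then have "x \<in> generate Fn (gen ` {1..n})" using generate_gen by simp
  moreover have "gen ` {1..n} \<subseteq> carrier Fn" using gen_in_carrier by blast
  ultimately show "\<phi> x = \<psi> x"
    using hom_eq_on_generate[OF F.group_axioms F.group_axioms auto_hom[OF assms(1)] auto_hom[OF assms(2)]]
      assms(3) by blast
qed

lemma auto_lower_central:
  "\<phi> \<in> auto Fn \<Longrightarrow> x \<in> lower_central Fn i \<Longrightarrow> \<phi> x \<in> lower_central Fn i"
  using hom_lower_central[OF F.group_axioms F.group_axioms auto_hom] .

lemma IA_iff:
  "\<phi> \<in> IA n \<longleftrightarrow> \<phi> \<in> auto Fn \<and> (\<forall>g\<in>carrier Fn. \<phi> g \<otimes>\<^bsub>Fn\<^esub> inv\<^bsub>Fn\<^esub> g \<in> lower_central Fn (Suc 1))"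
proof -
  have eq: "(lower_central Fn (Suc 1) #>\<^bsub>Fn\<^esub> a = lower_central Fn (Suc 1) #>\<^bsub>Fn\<^esub> b) \<longleftrightarrow>
      a \<otimes>\<^bsub>Fn\<^esub> inv\<^bsub>Fn\<^esub> b \<in> lower_central Fn (Suc 1)"
    if "a \<in> carrier Fn" "b \<in> carrier Fn" for a b
    using F.repr_independence[of a _ b] F.rcos_self subgroup.rcos_module[OF F.lower_central_subgroup F.group_axioms]
      F.lower_central_subgroup that by metis
  have "(\<forall>g\<in>carrier Fn. lower_central Fn (Suc 1) #>\<^bsub>Fn\<^esub> \<phi> g = lower_central Fn (Suc 1) #>\<^bsub>Fn\<^esub> g) \<longleftrightarrow>
      (\<forall>g\<in>carrier Fn. \<phi> g \<otimes>\<^bsub>Fn\<^esub> inv\<^bsub>Fn\<^esub> g \<in> lower_central Fn (Suc 1))" if "\<phi> \<in> auto Fn"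
    using eq[OF auto_closed[OF that]] by (intro ball_cong refl)
  then show ?thesis
    unfolding IA_def derived_eq_lower_central by blast
qed

lemma IA_displacement:
  assumes "\<phi> \<in> IA n" "i \<ge> 1" "g \<in> lower_central Fn i"
  shows "\<phi> g \<otimes>\<^bsub>Fn\<^esub> inv\<^bsub>Fn\<^esub> g \<in> lower_central Fn (Suc i)"
  using assms F.displacement_lower_central[of \<phi> i g] auto_hom by (auto simp: IA_iff)

lemma IA_subset_auto: "IA n \<subseteq> auto Fn"
  by (auto simp: IA_def)

lemma IA_I:
  assumes "\<phi> \<in> auto Fn"
    "\<And>i. i \<in> {1..n} \<Longrightarrow> \<phi> (gen i) \<otimes>\<^bsub>Fn\<^esub> inv\<^bsub>Fn\<^esub> (gen i) \<in> lower_central Fn (Suc 1)"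
  shows "\<phi> \<in> IA n"
  unfolding IA_iff
proof (intro conjI ballI assms)
  fix g assume "g \<in> carrier Fn"
  then have "g \<in> generate Fn (gen ` {1..n})" using generate_gen by simp
  moreover have "gen ` {1..n} \<subseteq> carrier Fn" using gen_in_carrier by blast
  ultimately show "\<phi> g \<otimes>\<^bsub>Fn\<^esub> inv\<^bsub>Fn\<^esub> g \<in> lower_central Fn (Suc 1)"
    using F.displacement_generate[OF auto_hom[OF assms(1)] F.lower_central_normal] assms(2) by blast
qed

section \<open>The Andreadakis filtration\<close>

abbreviation "filt \<equiv> andreadakis_filtration n"

lemma filt_D: "\<phi> \<in> filt j \<Longrightarrow> i \<ge> 1 \<Longrightarrow> g \<in> lower_central Fn i \<Longrightarrow>
    \<phi> g \<otimes>\<^bsub>Fn\<^esub> inv\<^bsub>Fn\<^esub> g \<in> lower_central Fn (i + j)"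
  by (simp add: andreadakis_filtration_def)

lemma subgroup_filt: "subgroup (filt j) Aut"
proof (rule A.subgroupI)
  note N = F.lower_central_normal and sub = F.lower_central_sub_carrier[THEN subsetD]
  show auto: "filt j \<subseteq> carrier Aut" by (auto simp: andreadakis_filtration_def)
  have "\<one>\<^bsub>Aut\<^esub> \<in> filt j"
    using Aut_closed(3) sub subgroup.one_closed[OF F.lower_central_subgroup]
    by (auto simp: andreadakis_filtration_def Aut_one_apply)
  then show "filt j \<noteq> {}" by blast
  fix \<phi> assume \<phi>: "\<phi> \<in> filt j"
  then have \<phi>a: "\<phi> \<in> auto Fn" using auto by auto
  show "inv\<^bsub>Aut\<^esub> \<phi> \<in> filt j"
    unfolding andreadakis_filtration_def
  proof (intro CollectI conjI allI impI ballI Aut_closed(2)[OF \<phi>a])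
    fix i g assume i: "i \<ge> (1::nat)" and g: "g \<in> lower_central Fn i"
    \<comment> \<open>The displacement of the inverse at \<open>g\<close> is the inverse of the
      displacement of \<open>\<phi>\<close> at this preimage of \<open>g\<close>.\<close>
    define h where "h = (inv\<^bsub>Aut\<^esub> \<phi>) g"
    have h: "h \<in> lower_central Fn i" unfolding h_def using auto_lower_central[OF Aut_closed(2)[OF \<phi>a] g] .
    have gh: "g = \<phi> h" unfolding h_def using Aut_inv_apply(1)[OF \<phi>a] g sub by metis
    have "inv\<^bsub>Fn\<^esub> (\<phi> h \<otimes>\<^bsub>Fn\<^esub> inv\<^bsub>Fn\<^esub> h) \<in> lower_central Fn (i + j)"
      using filt_D[OF \<phi> i h] by (rule subgroup.m_inv_closed[OF F.lower_central_subgroup])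
    then have "h \<otimes>\<^bsub>Fn\<^esub> inv\<^bsub>Fn\<^esub> g \<in> lower_central Fn (i + j)"
      using gh h g sub by (simp add: F.inv_mult_group)
    then show "(inv\<^bsub>Aut\<^esub> \<phi>) g \<otimes>\<^bsub>Fn\<^esub> inv\<^bsub>Fn\<^esub> g \<in> lower_central Fn (i + j)"
      by (simp add: h_def)
  qed
  fix \<psi> assume \<psi>: "\<psi> \<in> filt j"
  then have \<psi>a: "\<psi> \<in> auto Fn" using auto by auto
  show "\<phi> \<otimes>\<^bsub>Aut\<^esub> \<psi> \<in> filt j"
    unfolding andreadakis_filtration_def
  proof (intro CollectI conjI allI impI ballI Aut_closed(1)[OF \<phi>a \<psi>a])
    fix i g assume i: "i \<ge> (1::nat)" and g: "g \<in> lower_central Fn i"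
    then have gG: "g \<in> carrier Fn" using sub by blast
    have h: "\<psi> g \<in> lower_central Fn i" using auto_lower_central[OF \<psi>a g] .
    have hG: "\<psi> g \<in> carrier Fn" "\<phi> (\<psi> g) \<in> carrier Fn" using \<phi>a \<psi>a gG auto_closed by auto
    have "(\<phi> (\<psi> g) \<otimes>\<^bsub>Fn\<^esub> inv\<^bsub>Fn\<^esub> (\<psi> g)) \<otimes>\<^bsub>Fn\<^esub> (\<psi> g \<otimes>\<^bsub>Fn\<^esub> inv\<^bsub>Fn\<^esub> g) \<in> lower_central Fn (i + j)"
      using filt_D[OF \<phi> i h] filt_D[OF \<psi> i g] by (rule subgroup.m_closed[OF F.lower_central_subgroup])
    also have "(\<phi> (\<psi> g) \<otimes>\<^bsub>Fn\<^esub> inv\<^bsub>Fn\<^esub> (\<psi> g)) \<otimes>\<^bsub>Fn\<^esub> (\<psi> g \<otimes>\<^bsub>Fn\<^esub> inv\<^bsub>Fn\<^esub> g) = \<phi> (\<psi> g) \<otimes>\<^bsub>Fn\<^esub> inv\<^bsub>Fn\<^esub> g"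
      using gG hG by (simp add: F.word_simps)
    finally show "(\<phi> \<otimes>\<^bsub>Aut\<^esub> \<psi>) g \<otimes>\<^bsub>Fn\<^esub> inv\<^bsub>Fn\<^esub> g \<in> lower_central Fn (i + j)"
      using gG \<phi>a \<psi>a by (simp add: Aut_mult_apply)
  qed
qed

text \<open>Writing \<open>\<psi> h = u h\<close> and \<open>\<phi> h = v h\<close>, the displacement of \<open>[\<phi>, \<psi>]\<close> at \<open>\<psi> (\<phi> h)\<close> is
  \<open>\<phi> u u\<^sup>-\<^sup>1 [u, v] (\<psi> v v\<^sup>-\<^sup>1)\<^sup>-\<^sup>1\<close>.\<close>

lemma commutator_IA_filt:
  assumes \<phi>: "\<phi> \<in> IA n" and \<psi>: "\<psi> \<in> filt j"
  shows "A.commutator \<phi> \<psi> \<in> filt (Suc j)"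
proof -
  note sub = F.lower_central_sub_carrier[THEN subsetD]
  have a: "\<phi> \<in> auto Fn" "\<psi> \<in> auto Fn"
    using \<phi> \<psi> by (auto simp: IA_def andreadakis_filtration_def)
  let ?c = "A.commutator \<phi> \<psi>"
  have c: "?c \<in> auto Fn" using a A.commutator_closed by simp
  have eq: "?c \<otimes>\<^bsub>Aut\<^esub> (\<psi> \<otimes>\<^bsub>Aut\<^esub> \<phi>) = \<phi> \<otimes>\<^bsub>Aut\<^esub> \<psi>"
    using a A.commutator_mult_swap[of \<phi> \<psi>] by simp
  show ?thesis
    unfolding andreadakis_filtration_def
  proof (intro CollectI conjI allI impI ballI c)
    fix i g assume i: "i \<ge> (1::nat)" and g: "g \<in> lower_central Fn i"
    define h where "h = (inv\<^bsub>Aut\<^esub> (\<psi> \<otimes>\<^bsub>Aut\<^esub> \<phi>)) g"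
    have pa: "\<psi> \<otimes>\<^bsub>Aut\<^esub> \<phi> \<in> auto Fn" using a Aut_closed by blast
    have h: "h \<in> lower_central Fn i"
      unfolding h_def using auto_lower_central[OF Aut_closed(2)[OF pa] g] .
    have hG: "h \<in> carrier Fn" using h sub by blast
    have gh: "g = \<psi> (\<phi> h)"
      using Aut_inv_apply(1)[OF pa, of g] Aut_mult_apply[OF a(2,1) hG] g sub unfolding h_def by metis
    have cg: "?c g = \<phi> (\<psi> h)"
      using arg_cong[OF eq, of "\<lambda>f. f h"] Aut_mult_apply[OF c pa hG] Aut_mult_apply[OF a hG]
        Aut_mult_apply[OF a(2,1) hG] gh by simp
    define u v where "u = \<psi> h \<otimes>\<^bsub>Fn\<^esub> inv\<^bsub>Fn\<^esub> h" and "v = \<phi> h \<otimes>\<^bsub>Fn\<^esub> inv\<^bsub>Fn\<^esub> h"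
    have u: "u \<in> lower_central Fn (i + j)" unfolding u_def by (rule filt_D[OF \<psi> i h])
    have v: "v \<in> lower_central Fn (Suc i)" unfolding v_def by (rule IA_displacement[OF \<phi> i h])
    have uvG: "u \<in> carrier Fn" "v \<in> carrier Fn" "\<phi> u \<in> carrier Fn" "\<psi> v \<in> carrier Fn"
      using u v sub a auto_closed by blast+
    have e: "\<psi> h = u \<otimes>\<^bsub>Fn\<^esub> h" "\<phi> h = v \<otimes>\<^bsub>Fn\<^esub> h"
      unfolding u_def v_def using hG a auto_closed by (simp_all add: F.word_simps)
    have m1: "\<phi> u \<otimes>\<^bsub>Fn\<^esub> inv\<^bsub>Fn\<^esub> u \<in> lower_central Fn (i + Suc j)"
      using IA_displacement[OF \<phi> _ u] i by simp
    have m2: "F.commutator u v \<in> lower_central Fn (i + Suc j)"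
      using F.commutator_lower_central[OF u v] F.lower_central_antimono[of "i + Suc j" "i + j + Suc i"]
      by auto
    have m3: "inv\<^bsub>Fn\<^esub> (\<psi> v \<otimes>\<^bsub>Fn\<^esub> inv\<^bsub>Fn\<^esub> v) \<in> lower_central Fn (i + Suc j)"
      using filt_D[OF \<psi> _ v] by (intro subgroup.m_inv_closed[OF F.lower_central_subgroup]) simp
    have "\<phi> u \<otimes>\<^bsub>Fn\<^esub> inv\<^bsub>Fn\<^esub> u \<otimes>\<^bsub>Fn\<^esub> F.commutator u v \<otimes>\<^bsub>Fn\<^esub>
        inv\<^bsub>Fn\<^esub> (\<psi> v \<otimes>\<^bsub>Fn\<^esub> inv\<^bsub>Fn\<^esub> v) \<in> lower_central Fn (i + Suc j)"
      by (rule subgroup.m_closed[OF F.lower_central_subgroup subgroup.m_closed[OF F.lower_central_subgroup m1 m2] m3])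
    also have "\<phi> u \<otimes>\<^bsub>Fn\<^esub> inv\<^bsub>Fn\<^esub> u \<otimes>\<^bsub>Fn\<^esub> F.commutator u v \<otimes>\<^bsub>Fn\<^esub>
        inv\<^bsub>Fn\<^esub> (\<psi> v \<otimes>\<^bsub>Fn\<^esub> inv\<^bsub>Fn\<^esub> v) = \<phi> (\<psi> h) \<otimes>\<^bsub>Fn\<^esub> inv\<^bsub>Fn\<^esub> (\<psi> (\<phi> h))"
    proof -
      have "\<phi> (\<psi> h) = \<phi> u \<otimes>\<^bsub>Fn\<^esub> (v \<otimes>\<^bsub>Fn\<^esub> h)" "\<psi> (\<phi> h) = \<psi> v \<otimes>\<^bsub>Fn\<^esub> (u \<otimes>\<^bsub>Fn\<^esub> h)"
        using hom_mult[OF auto_hom[OF a(1)] uvG(1) hG] hom_mult[OF auto_hom[OF a(2)] uvG(2) hG] e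
        by simp_all
      then show ?thesis
        using uvG hG by (simp add: F.commutator_def F.word_simps)
    qed
    finally show "?c g \<otimes>\<^bsub>Fn\<^esub> inv\<^bsub>Fn\<^esub> g \<in> lower_central Fn (i + Suc j)"
      using gh cg by simp
  qed
qed

text \<open>The base case is that IA_n acts trivially on all Gamma_i/Gamma_(i+1). The step holds
  because \<open>commutator_IA_filt\<close> puts the generating commutators into a subgroup.\<close>

lemma lower_central_IA_subset_filt:
  "j \<ge> 1 \<Longrightarrow> lower_central (IA_group n) j \<subseteq> filt j"
proof (induction j rule: nat_induct_at_least)
  case base
  show ?case
    using IA_displacement IA_subset_auto by (auto simp: IA_group_def andreadakis_filtration_def)
next
  case (Suc j)
  interpret I: group "IA_group n" by (rule group_IA_group)
  have carr: "carrier (IA_group n) = IA n" by (simp add: IA_group_def)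
  have sg: "subgroup (filt (Suc j) \<inter> IA n) (IA_group n)"
    unfolding IA_group_def
    by (rule A.subgroup_incl[OF A.subgroups_Inter_pair[OF subgroup_filt subgroup_IA] subgroup_IA]) auto
  have mem: "I.commutator \<phi> \<psi> \<in> filt (Suc j) \<inter> IA n"
    if "\<phi> \<in> IA n" "\<psi> \<in> lower_central (IA_group n) j" for \<phi> \<psi>
  proof -
    have \<psi>: "\<psi> \<in> IA n" using that(2) I.lower_central_sub_carrier carr by blast
    have "I.commutator \<phi> \<psi> = A.commutator \<phi> \<psi>"
      using that(1) \<psi> A.m_inv_consistent[OF subgroup_IA]
      unfolding I.commutator_def A.commutator_def unfolding IA_group_def by simp
    moreover have "I.commutator \<phi> \<psi> \<in> IA n"
      using I.commutator_closed[of \<phi> \<psi>] that(1) \<psi> carr by simp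
    ultimately show ?thesis using commutator_IA_filt[OF that(1)] Suc.IH that(2) by auto
  qed
  have "lower_central (IA_group n) (Suc j) \<subseteq> filt (Suc j) \<inter> IA n"
    unfolding I.lower_central_Suc[OF Suc.hyps] carr
    by (rule I.generate_subgroup_incl[OF _ sg]) (use mem in blast)
  then show ?case by blast
qed

section \<open>Conjugations and inner automorphisms\<close>

lemma conj_by_closed: "x \<in> carrier Fn \<Longrightarrow> w \<in> carrier Fn \<Longrightarrow> conj_by Fn x w \<in> carrier Fn"
  by (simp add: conj_by_def)

lemma conj_by_mult:
  "x \<in> carrier Fn \<Longrightarrow> y \<in> carrier Fn \<Longrightarrow> w \<in> carrier Fn \<Longrightarrow>
    conj_by Fn (x \<otimes>\<^bsub>Fn\<^esub> y) w = conj_by Fn x w \<otimes>\<^bsub>Fn\<^esub> conj_by Fn y w"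
  by (simp add: conj_by_def F.word_simps)

lemma conj_by_conj_by:
  "x \<in> carrier Fn \<Longrightarrow> v \<in> carrier Fn \<Longrightarrow> w \<in> carrier Fn \<Longrightarrow>
    conj_by Fn (conj_by Fn x w) v = conj_by Fn x (w \<otimes>\<^bsub>Fn\<^esub> v)"
  by (simp add: conj_by_def F.word_simps)

lemma conj_by_one: "x \<in> carrier Fn \<Longrightarrow> conj_by Fn x \<one>\<^bsub>Fn\<^esub> = x"
  by (simp add: conj_by_def)

lemma conj_by_displacement:
  "x \<in> carrier Fn \<Longrightarrow> w \<in> carrier Fn \<Longrightarrow>
    conj_by Fn x w \<otimes>\<^bsub>Fn\<^esub> inv\<^bsub>Fn\<^esub> x = F.commutator (inv\<^bsub>Fn\<^esub> w) x"
  by (simp add: conj_by_def F.commutator_def)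

lemma hom_conj_by:
  "\<phi> \<in> hom Fn Fn \<Longrightarrow> x \<in> carrier Fn \<Longrightarrow> w \<in> carrier Fn \<Longrightarrow>
    \<phi> (conj_by Fn x w) = conj_by Fn (\<phi> x) (\<phi> w)"
  by (simp add: conj_by_def group_hom.hom_inv[of Fn Fn \<phi>] group_hom_def group_hom_axioms_def hom_mult F.group_axioms)

definition inner :: "letter list \<Rightarrow> letter list \<Rightarrow> letter list" where
  "inner w = (\<lambda>x\<in>carrier Fn. conj_by Fn x w)"

lemma inner_apply: "x \<in> carrier Fn \<Longrightarrow> inner w x = conj_by Fn x w"
  by (simp add: inner_def)

lemma auto_I:
  assumes "f \<in> hom Fn Fn" "f \<in> extensional (carrier Fn)" "g \<in> carrier Fn \<rightarrow> carrier Fn"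
    "\<And>x. x \<in> carrier Fn \<Longrightarrow> g (f x) = x" "\<And>x. x \<in> carrier Fn \<Longrightarrow> f (g x) = x"
  shows "f \<in> auto Fn"
proof -
  have "bij_betw f (carrier Fn) (carrier Fn)"
    using assms by (intro bij_betw_byWitness[of _ g]) (auto simp: hom_def)
  then show ?thesis using assms by (simp add: auto_def Bij_def)
qed

lemma inner_auto:
  assumes w: "w \<in> carrier Fn"
  shows "inner w \<in> auto Fn"
proof (rule auto_I)
  show "inner w \<in> hom Fn Fn"
    using w by (intro homI) (auto simp: inner_apply conj_by_closed conj_by_mult)
  show "inner (inv\<^bsub>Fn\<^esub> w) \<in> carrier Fn \<rightarrow> carrier Fn"
    using w by (auto simp: inner_apply conj_by_closed)
qed (use w in \<open>auto simp: inner_def conj_by_closed conj_by_conj_by conj_by_one\<close>)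

lemma Inn_eq: "Inn Fn = inner ` carrier Fn"
  by (auto simp: Inn_def inner_def)

lemma inner_mult:
  assumes "v \<in> carrier Fn" "w \<in> carrier Fn"
  shows "inner v \<otimes>\<^bsub>Aut\<^esub> inner w = inner (w \<otimes>\<^bsub>Fn\<^esub> v)"
  using assms
  by (intro auto_eqI Aut_closed inner_auto)
    (auto simp: Aut_mult_apply inner_auto inner_apply conj_by_closed conj_by_conj_by gen_in_carrier)

lemma inner_one: "inner \<one>\<^bsub>Fn\<^esub> = \<one>\<^bsub>Aut\<^esub>"
  by (intro auto_eqI Aut_closed inner_auto) (auto simp: Aut_one_apply inner_apply conj_by_one gen_in_carrier)

text \<open>With x^w = w^-1 x w the map \<open>inner\<close> reverses products; inverting
  \<open>w\<close> first restores their order.\<close>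

lemma inner_hom: "(\<lambda>w. inner (inv\<^bsub>Fn\<^esub> w)) \<in> hom Fn Aut"
  by (rule homI) (auto simp: inner_auto inner_mult F.inv_mult_group)

lemma auto_inner:
  assumes "\<phi> \<in> auto Fn" "w \<in> carrier Fn"
  shows "\<phi> \<otimes>\<^bsub>Aut\<^esub> inner w = inner (\<phi> w) \<otimes>\<^bsub>Aut\<^esub> \<phi>"
proof -
  note w = inner_auto[OF assms(2)] and m = inner_auto[OF auto_closed[OF assms]]
  show ?thesis
  proof (rule auto_eqI[OF Aut_closed(1)[OF assms(1) w] Aut_closed(1)[OF m assms(1)]])
    fix i assume "i \<in> {1..n}"
    then have g: "gen i \<in> carrier Fn" by (rule gen_in_carrier)
    then show "(\<phi> \<otimes>\<^bsub>Aut\<^esub> inner w) (gen i) = (inner (\<phi> w) \<otimes>\<^bsub>Aut\<^esub> \<phi>) (gen i)"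
      using assms w m by (simp add: Aut_mult_apply inner_apply auto_closed hom_conj_by auto_hom)
  qed
qed

lemma Inn_normal: "Inn Fn \<lhd> Aut"
proof -
  have eq: "Inn Fn = (\<lambda>w. inner (inv\<^bsub>Fn\<^esub> w)) ` carrier Fn"
    unfolding Inn_eq using F.inv_closed F.inv_inv by (safe intro!: imageI) (metis image_eqI)
  have "group_hom Fn Aut (\<lambda>w. inner (inv\<^bsub>Fn\<^esub> w))"
    using inner_hom F.group_axioms A.group_axioms by (simp add: group_hom_def group_hom_axioms_def)
  then have sg: "subgroup (Inn Fn) Aut"
    unfolding eq by (rule group_hom.img_is_subgroup)
  have "\<phi> \<otimes>\<^bsub>Aut\<^esub> f \<otimes>\<^bsub>Aut\<^esub> inv\<^bsub>Aut\<^esub> \<phi> \<in> Inn Fn" if \<phi>: "\<phi> \<in> auto Fn" and f: "f \<in> Inn Fn" for \<phi> f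
  proof -
    obtain w where w: "w \<in> carrier Fn" "f = inner w" using f by (auto simp: Inn_eq)
    have "\<phi> \<otimes>\<^bsub>Aut\<^esub> f \<otimes>\<^bsub>Aut\<^esub> inv\<^bsub>Aut\<^esub> \<phi> = inner (\<phi> w)"
      using w \<phi> auto_inner[OF \<phi> w(1)] A.m_assoc[of "inner (\<phi> w)" \<phi> "inv\<^bsub>Aut\<^esub> \<phi>"]
      by (simp add: inner_auto auto_closed Aut_closed del: A.m_assoc)
    then show ?thesis using w \<phi> by (simp add: Inn_eq auto_closed)
  qed
  then show ?thesis using sg by (simp add: A.normal_inv_iff)
qed

section \<open>Triangular basis-conjugating automorphisms\<close>

abbreviation (input) "gens_below i \<equiv> generate Fn (gen ` {1..<i})"

lemma gens_below_carrier: "i \<le> Suc n \<Longrightarrow> gen ` {1..<i} \<subseteq> carrier Fn"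
  using gen_in_carrier by fastforce

lemma subgroup_gens_below: "i \<le> Suc n \<Longrightarrow> subgroup (gens_below i) Fn"
  using gens_below_carrier by (intro F.generate_is_subgroup)

lemma gens_below_subset: "i \<le> Suc n \<Longrightarrow> gens_below i \<subseteq> carrier Fn"
  by (rule subgroup.subset[OF subgroup_gens_below])

lemma gens_below_mono: "i \<le> j \<Longrightarrow> gens_below i \<subseteq> gens_below j"
  by (intro F.mono_generate) auto

lemma gen_in_gens_below: "1 \<le> l \<Longrightarrow> l < i \<Longrightarrow> gen l \<in> gens_below i"
  by (intro generate.incl) auto

lemma conj_by_in_subgroup:
  "subgroup H Fn \<Longrightarrow> x \<in> H \<Longrightarrow> w \<in> H \<Longrightarrow> conj_by Fn x w \<in> H"
  unfolding conj_by_def by (intro subgroup.m_closed subgroup.m_inv_closed)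

abbreviation (input) "Tri \<equiv> triangular_McCool n"

lemma Tri_auto: "\<phi> \<in> Tri \<Longrightarrow> \<phi> \<in> auto Fn"
  by (simp add: triangular_McCool_def)

lemma Tri_E:
  assumes "\<phi> \<in> Tri"
  obtains w where "\<And>i. i \<in> {1..n} \<Longrightarrow> w i \<in> gens_below i" "\<And>i. i \<in> {1..n} \<Longrightarrow> w i \<in> carrier Fn"
    "\<And>i. i \<in> {1..n} \<Longrightarrow> \<phi> (gen i) = conj_by Fn (gen i) (w i)"
proof -
  obtain w where w: "\<forall>i\<in>{1..n}. w i \<in> gens_below i \<and> \<phi> (gen i) = conj_by Fn (gen i) (w i)"
    using assms by (auto simp: triangular_McCool_def)
  then have "w i \<in> carrier Fn" if "i \<in> {1..n}" for i
    using gens_below_subset[of i] that by auto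
  then show thesis using w that[of w] by blast
qed

lemma Tri_I:
  assumes "\<phi> \<in> auto Fn" "\<And>i. i \<in> {1..n} \<Longrightarrow> \<exists>w\<in>gens_below i. \<phi> (gen i) = conj_by Fn (gen i) w"
  shows "\<phi> \<in> Tri"
proof -
  have "\<forall>i\<in>{1..n}. \<exists>w. w \<in> gens_below i \<and> \<phi> (gen i) = conj_by Fn (gen i) w"
    using assms(2) by blast
  from bchoice[OF this] show ?thesis using assms(1) by (auto simp: triangular_McCool_def)
qed

text \<open>For surjectivity, the conjugator of x_(i+1) lies in a subgroup already known to be hit,
  so x_(i+1) is recovered by conjugating its image back. This is what makes inverses of triangular
  automorphisms triangular.\<close>

lemma Tri_image_gens_below:
  assumes \<phi>: "\<phi> \<in> Tri" and "i \<le> n"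
  shows "\<phi> ` gens_below (Suc i) = gens_below (Suc i)"
  using \<open>i \<le> n\<close>
proof (induction i)
  case 0
  interpret \<phi>: group_hom Fn Fn \<phi> using auto_group_hom[OF Tri_auto[OF \<phi>]] .
  show ?case by (simp add: F.generate_empty)
next
  case (Suc i)
  obtain w where w: "\<And>i. i \<in> {1..n} \<Longrightarrow> w i \<in> gens_below i" "\<And>i. i \<in> {1..n} \<Longrightarrow> w i \<in> carrier Fn"
    "\<And>i. i \<in> {1..n} \<Longrightarrow> \<phi> (gen i) = conj_by Fn (gen i) (w i)"
    using Tri_E[OF \<phi>] by metis
  interpret \<phi>: group_hom Fn Fn \<phi> using auto_group_hom[OF Tri_auto[OF \<phi>]] .
  let ?H = "gens_below (Suc (Suc i))"
  have le: "Suc (Suc i) \<le> Suc n" using Suc.prems by simp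
  note sgH = subgroup_gens_below[OF le]
  have sgI: "subgroup (\<phi> ` ?H) Fn" using \<phi>.subgroup_img_is_subgroup[OF sgH] .
  have mem: "Suc i \<in> {1..n}" using Suc.prems by simp
  show ?case
  proof
    have "\<phi> ` gen ` {1..<Suc (Suc i)} \<subseteq> ?H"
    proof (clarify)
      fix l assume l: "l \<in> {1..<Suc (Suc i)}"
      then have "w l \<in> ?H" using w(1)[of l] Suc.prems gens_below_mono[of l "Suc (Suc i)"] by auto
      then show "\<phi> (gen l) \<in> ?H"
        using l w(3)[of l] Suc.prems conj_by_in_subgroup[OF sgH gen_in_gens_below] by auto
    qed
    then show "\<phi> ` ?H \<subseteq> ?H"
      unfolding \<phi>.generate_img[OF gens_below_carrier[OF le], symmetric]
      by (rule F.generate_subgroup_incl[OF _ sgH])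
    have IH: "gens_below (Suc i) \<subseteq> \<phi> ` ?H"
      using Suc gens_below_mono[of "Suc i" "Suc (Suc i)"] by (metis Suc_leD image_mono le_SucI order_refl)
    show "?H \<subseteq> \<phi> ` ?H"
    proof (rule F.generate_subgroup_incl[OF _ sgI], clarify)
      fix l assume l: "l \<in> {1..<Suc (Suc i)}"
      show "gen l \<in> \<phi> ` ?H"
      proof (cases "l = Suc i")
        case True
        have wi: "w (Suc i) \<in> \<phi> ` ?H" using w(1)[OF mem] IH by blast
        have "\<phi> (gen (Suc i)) \<in> \<phi> ` ?H" using gen_in_gens_below[of "Suc i" "Suc (Suc i)"] by auto
        then have "conj_by Fn (\<phi> (gen (Suc i))) (inv\<^bsub>Fn\<^esub> (w (Suc i))) \<in> \<phi> ` ?H"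
          using wi by (intro conj_by_in_subgroup[OF sgI] subgroup.m_inv_closed[OF sgI])
        then show ?thesis
          using w(2,3)[OF mem] gen_in_carrier[OF mem] True
          by (simp add: conj_by_conj_by conj_by_one)
      next
        case False
        then show ?thesis using l gen_in_gens_below[of l "Suc i"] IH by auto
      qed
    qed
  qed
qed

lemma Tri_image_below: "\<phi> \<in> Tri \<Longrightarrow> i \<in> {1..n} \<Longrightarrow> \<phi> ` gens_below i = gens_below i"
  using Tri_image_gens_below[of \<phi> "i - 1"] by (cases i) simp_all

lemma subgroup_Tri: "subgroup Tri Aut"
proof (rule A.subgroupI)
  show "Tri \<subseteq> carrier Aut" by (auto simp: Tri_auto)
  have "\<one>\<^bsub>Aut\<^esub> \<in> Tri"
    using generate.one[of Fn]
    by (intro Tri_I Aut_closed) (auto simp: Aut_one_apply gen_in_carrier conj_by_one intro!: bexI[of _ "\<one>\<^bsub>Fn\<^esub>"])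
  then show "Tri \<noteq> {}" by blast
  fix \<phi> assume \<phi>: "\<phi> \<in> Tri"
  obtain w where w: "\<And>i. i \<in> {1..n} \<Longrightarrow> w i \<in> gens_below i" "\<And>i. i \<in> {1..n} \<Longrightarrow> w i \<in> carrier Fn"
    "\<And>i. i \<in> {1..n} \<Longrightarrow> \<phi> (gen i) = conj_by Fn (gen i) (w i)"
    using Tri_E[OF \<phi>] by metis
  note \<phi>a = Tri_auto[OF \<phi>]
  show "inv\<^bsub>Aut\<^esub> \<phi> \<in> Tri"
  proof (rule Tri_I[OF Aut_closed(2)[OF \<phi>a]])
    fix i assume i: "i \<in> {1..n}"
    \<comment> \<open>The conjugator for the inverse automorphism is the inverse of the preimage of
      \<open>w i\<close>, which exists within the same subgroup.\<close>
    obtain v where v: "v \<in> gens_below i" "w i = \<phi> v"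
      using w(1)[OF i] Tri_image_below[OF \<phi> i] by blast
    have iv: "inv\<^bsub>Fn\<^esub> v \<in> gens_below i"
      using v(1) i subgroup_gens_below[of i] by (auto intro: subgroup.m_inv_closed)
    have vG: "v \<in> carrier Fn" using v(1) gens_below_subset[of i] i by auto
    have g: "gen i \<in> carrier Fn" using gen_in_carrier[OF i] .
    have "\<phi> (conj_by Fn (gen i) (inv\<^bsub>Fn\<^esub> v)) = conj_by Fn (conj_by Fn (gen i) (w i)) (inv\<^bsub>Fn\<^esub> (\<phi> v))"
      using w(3)[OF i] g vG \<phi>a group_hom.hom_inv[OF auto_group_hom[OF \<phi>a] vG] by (simp add: hom_conj_by auto_hom)
    also have "\<dots> = gen i"
      using v(2) w(2)[OF i] g by (simp add: conj_by_conj_by conj_by_one)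
    finally have "(inv\<^bsub>Aut\<^esub> \<phi>) (gen i) = conj_by Fn (gen i) (inv\<^bsub>Fn\<^esub> v)"
      using Aut_inv_apply(2)[OF \<phi>a, of "conj_by Fn (gen i) (inv\<^bsub>Fn\<^esub> v)"] g vG by (simp add: conj_by_closed)
    then show "\<exists>w\<in>gens_below i. (inv\<^bsub>Aut\<^esub> \<phi>) (gen i) = conj_by Fn (gen i) w" using iv by blast
  qed
  fix \<psi> assume \<psi>: "\<psi> \<in> Tri"
  obtain u where u: "\<And>i. i \<in> {1..n} \<Longrightarrow> u i \<in> gens_below i" "\<And>i. i \<in> {1..n} \<Longrightarrow> u i \<in> carrier Fn"
    "\<And>i. i \<in> {1..n} \<Longrightarrow> \<psi> (gen i) = conj_by Fn (gen i) (u i)"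
    using Tri_E[OF \<psi>] by metis
  note \<psi>a = Tri_auto[OF \<psi>]
  show "\<phi> \<otimes>\<^bsub>Aut\<^esub> \<psi> \<in> Tri"
  proof (rule Tri_I[OF Aut_closed(1)[OF \<phi>a \<psi>a]])
    fix i assume i: "i \<in> {1..n}"
    \<comment> \<open>Applying \<open>\<phi>\<close> to x_i^(u_i) conjugates x_i by
      \<open>w i\<close> and then by the image of \<open>u i\<close>.\<close>
    have m: "w i \<otimes>\<^bsub>Fn\<^esub> \<phi> (u i) \<in> gens_below i"
      using w(1)[OF i] u(1)[OF i] Tri_image_below[OF \<phi> i] i
      by (intro subgroup.m_closed[OF subgroup_gens_below]) auto
    have "(\<phi> \<otimes>\<^bsub>Aut\<^esub> \<psi>) (gen i) = conj_by Fn (gen i) (w i \<otimes>\<^bsub>Fn\<^esub> \<phi> (u i))"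
      using \<phi>a \<psi>a gen_in_carrier[OF i] u(2,3)[OF i] w(2,3)[OF i]
      by (simp add: Aut_mult_apply hom_conj_by auto_hom conj_by_conj_by auto_closed)
    then show "\<exists>w\<in>gens_below i. (\<phi> \<otimes>\<^bsub>Aut\<^esub> \<psi>) (gen i) = conj_by Fn (gen i) w" using m by blast
  qed
qed

lemma conj_by_IA:
  assumes "\<phi> \<in> auto Fn" "\<And>i. i \<in> {1..n} \<Longrightarrow> \<exists>w\<in>carrier Fn. \<phi> (gen i) = conj_by Fn (gen i) w"
  shows "\<phi> \<in> IA n"
proof (rule IA_I[OF assms(1)])
  fix i assume i: "i \<in> {1..n}"
  obtain w where w: "w \<in> carrier Fn" "\<phi> (gen i) = conj_by Fn (gen i) w" using assms(2)[OF i] by blast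
  have "F.commutator (inv\<^bsub>Fn\<^esub> w) (gen i) \<in> lower_central Fn (Suc 1)"
    using w gen_in_carrier[OF i] by (intro F.commutator_lower_central_Suc) auto
  then show "\<phi> (gen i) \<otimes>\<^bsub>Fn\<^esub> inv\<^bsub>Fn\<^esub> gen i \<in> lower_central Fn (Suc 1)"
    using w gen_in_carrier[OF i] by (simp only: conj_by_displacement)
qed

section \<open>The partial inner automorphism group\<close>

abbreviation (input) "K \<equiv> partial_inner n"

lemma subgroup_K_Aut: "subgroup K Aut"
  unfolding partial_inner_def by (rule A.mult_norm_subgroup[OF Inn_normal subgroup_Tri])

lemma K_I: "w \<in> carrier Fn \<Longrightarrow> \<psi> \<in> Tri \<Longrightarrow> inner w \<otimes>\<^bsub>Aut\<^esub> \<psi> \<in> K"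
  unfolding partial_inner_def Inn_eq set_mult_def by blast

lemma K_E:
  assumes "\<phi> \<in> K"
  obtains w \<psi> where "w \<in> carrier Fn" "\<psi> \<in> Tri" "\<phi> = inner w \<otimes>\<^bsub>Aut\<^esub> \<psi>"
  using assms unfolding partial_inner_def Inn_eq set_mult_def by blast

lemma inner_in_K: "w \<in> carrier Fn \<Longrightarrow> inner w \<in> K"
  using K_I[of w "\<one>\<^bsub>Aut\<^esub>"] subgroup.one_closed[OF subgroup_Tri] A.r_one[of "inner w"] by (simp add: inner_auto)

lemma Tri_in_K: "\<psi> \<in> Tri \<Longrightarrow> \<psi> \<in> K"
  using K_I[of "\<one>\<^bsub>Fn\<^esub>" \<psi>] A.l_one[of \<psi>] by (simp add: inner_one Tri_auto)

lemma K_subset_IA: "K \<subseteq> IA n"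
proof
  fix \<phi> assume "\<phi> \<in> K"
  then obtain w \<psi> where w: "w \<in> carrier Fn" and \<psi>: "\<psi> \<in> Tri" and \<phi>: "\<phi> = inner w \<otimes>\<^bsub>Aut\<^esub> \<psi>"
    by (rule K_E)
  have "inner w \<in> IA n"
    using w by (intro conj_by_IA inner_auto) (auto simp: inner_apply gen_in_carrier)
  moreover have "\<psi> \<in> IA n"
    using Tri_E[OF \<psi>] by (intro conj_by_IA Tri_auto[OF \<psi>]) metis
  ultimately show "\<phi> \<in> IA n" unfolding \<phi> by (rule subgroup.m_closed[OF subgroup_IA])
qed

abbreviation (input) "KG \<equiv> (IA_group n)\<lparr>carrier := K\<rparr>"

lemma KG_eq: "KG = Aut\<lparr>carrier := K\<rparr>"
  by (simp add: IA_group_def)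

lemma subgroup_K: "subgroup K (IA_group n)"
  unfolding IA_group_def by (rule A.subgroup_incl[OF subgroup_K_Aut subgroup_IA K_subset_IA])

lemma group_KG: "group KG"
  by (rule subgroup.subgroup_is_group[OF subgroup_K group_IA_group])

lemma hom_into_KG: "f \<in> hom Fn Aut \<Longrightarrow> f ` carrier Fn \<subseteq> K \<Longrightarrow> f \<in> hom Fn KG"
  by (auto simp: KG_eq hom_def)

text \<open>Functoriality along the homomorphism that sends \<open>w\<close> to conjugation by its
  inverse.\<close>

lemma inner_lower_central:
  assumes "w \<in> lower_central Fn j"
  shows "inner w \<in> lower_central KG j"
proof -
  have "(\<lambda>w. inner (inv\<^bsub>Fn\<^esub> w)) \<in> hom Fn KG"
    using inner_hom inner_in_K by (intro hom_into_KG) auto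
  from hom_lower_central[OF F.group_axioms group_KG this subgroup.m_inv_closed[OF F.lower_central_subgroup assms]]
  show ?thesis using assms F.lower_central_sub_carrier[of j] by (simp add: subset_iff)
qed

lemma lower_central_KG_subset: "lower_central KG j \<subseteq> lower_central (IA_group n) j"
proof -
  have "id \<in> hom KG (IA_group n)"
    using K_subset_IA by (auto simp: hom_def IA_group_def)
  then show ?thesis using hom_lower_central[OF group_KG group_IA_group] by fastforce
qed


section \<open>Automorphisms conjugating a single generator\<close>

definition endo :: "(nat \<Rightarrow> letter list) \<Rightarrow> letter list \<Rightarrow> letter list" where
  "endo f = (SOME h. h \<in> hom Fn Fn \<and> h \<in> extensional (carrier Fn) \<and> (\<forall>i\<in>{1..n}. h (gen i) = f i))"

lemma endo:
  assumes "\<And>i. i \<in> {1..n} \<Longrightarrow> f i \<in> carrier Fn"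
  shows "endo f \<in> hom Fn Fn" "endo f \<in> extensional (carrier Fn)"
    "\<And>i. i \<in> {1..n} \<Longrightarrow> endo f (gen i) = f i"
proof -
  have "\<exists>h. h \<in> hom Fn Fn \<and> h \<in> extensional (carrier Fn) \<and> (\<forall>i\<in>{1..n}. h (gen i) = f i)"
    using ex1_implies_ex[OF free_group_universal[OF F.group_axioms assms]] by (simp only: Int_iff conj_assoc)
  from someI_ex[OF this] show "endo f \<in> hom Fn Fn" "endo f \<in> extensional (carrier Fn)"
    "\<And>i. i \<in> {1..n} \<Longrightarrow> endo f (gen i) = f i"
    unfolding endo_def by blast+
qed

definition partial_conj :: "nat \<Rightarrow> letter list \<Rightarrow> letter list \<Rightarrow> letter list" where
  "partial_conj m w = endo (\<lambda>i. if i = m then conj_by Fn (gen m) w else gen i)"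

context
  fixes m :: nat
  assumes m: "m \<in> {1..n}"
begin

lemma below_carrier: "w \<in> gens_below m \<Longrightarrow> w \<in> carrier Fn"
  using gens_below_subset[of m] m by auto

lemma
  assumes "w \<in> carrier Fn"
  shows partial_conj_hom: "partial_conj m w \<in> hom Fn Fn"
    and partial_conj_ext: "partial_conj m w \<in> extensional (carrier Fn)"
    and partial_conj_gen: "\<And>i. i \<in> {1..n} \<Longrightarrow>
      partial_conj m w (gen i) = (if i = m then conj_by Fn (gen m) w else gen i)"
proof -
  have "(if i = m then conj_by Fn (gen m) w else gen i) \<in> carrier Fn" if "i \<in> {1..n}" for i
    using that assms gen_in_carrier[OF m] gen_in_carrier[OF that] by (simp add: conj_by_closed)
  note * = endo[of "\<lambda>i. if i = m then conj_by Fn (gen m) w else gen i", OF this, folded partial_conj_def]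
  show "partial_conj m w \<in> hom Fn Fn" "partial_conj m w \<in> extensional (carrier Fn)"
    "\<And>i. i \<in> {1..n} \<Longrightarrow> partial_conj m w (gen i) = (if i = m then conj_by Fn (gen m) w else gen i)"
    using * by blast+
qed

lemma partial_conj_fixes:
  assumes "w \<in> carrier Fn" "x \<in> gens_below m"
  shows "partial_conj m w x = x"
proof -
  have id: "id \<in> hom Fn Fn" by (simp add: hom_def)
  have "partial_conj m w x = id x"
  proof (rule hom_eq_on_generate[OF F.group_axioms F.group_axioms partial_conj_hom[OF assms(1)] id _ _ assms(2)])
    show "gen ` {1..<m} \<subseteq> carrier Fn" using gens_below_carrier[of m] m by simp
    fix s assume "s \<in> gen ` {1..<m}"
    then show "partial_conj m w s = id s" using partial_conj_gen[OF assms(1)] m by auto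
  qed
  then show ?thesis by simp
qed

lemma partial_conj_closed: "w \<in> carrier Fn \<Longrightarrow> x \<in> carrier Fn \<Longrightarrow> partial_conj m w x \<in> carrier Fn"
  using partial_conj_hom by (auto simp: hom_def)

text \<open>The outer map fixes \<open>v\<close>, which avoids x_m, and sends x_m^v to (x_m^w)^v.
  So, unlike for \<open>inner\<close>, the order of the product is kept.\<close>

lemma partial_conj_partial_conj:
  assumes w: "w \<in> gens_below m" and v: "v \<in> gens_below m" and x: "x \<in> carrier Fn"
  shows "partial_conj m w (partial_conj m v x) = partial_conj m (w \<otimes>\<^bsub>Fn\<^esub> v) x"
proof -
  note wG = below_carrier[OF w] and vG = below_carrier[OF v]
  have wv: "w \<otimes>\<^bsub>Fn\<^esub> v \<in> carrier Fn" using wG vG by simp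
  have h: "partial_conj m w \<circ> partial_conj m v \<in> hom Fn Fn"
    using hom_mult[OF partial_conj_hom[OF wG]] hom_mult[OF partial_conj_hom[OF vG]] wG vG
    by (intro homI) (auto simp: partial_conj_closed)
  have "(partial_conj m w \<circ> partial_conj m v) x = partial_conj m (w \<otimes>\<^bsub>Fn\<^esub> v) x"
  proof (rule hom_eq_on_generate[OF F.group_axioms F.group_axioms h partial_conj_hom[OF wv]])
    show "x \<in> generate Fn (gen ` {1..n})" using x generate_gen by simp
    show "gen ` {1..n} \<subseteq> carrier Fn" using gen_in_carrier by blast
    fix s assume "s \<in> gen ` {1..n}"
    then obtain i where i: "i \<in> {1..n}" "s = gen i" by blast
    then show "(partial_conj m w \<circ> partial_conj m v) s = partial_conj m (w \<otimes>\<^bsub>Fn\<^esub> v) s"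
      using partial_conj_gen[OF wG] partial_conj_gen[OF vG] partial_conj_gen[OF wv]
        hom_conj_by[OF partial_conj_hom[OF wG] gen_in_carrier[OF m] vG] partial_conj_fixes[OF wG v]
        gen_in_carrier[OF m] wG vG
      by (simp add: conj_by_conj_by m)
  qed
  then show ?thesis by simp
qed

lemma partial_conj_auto:
  assumes w: "w \<in> gens_below m"
  shows "partial_conj m w \<in> auto Fn"
proof (rule auto_I)
  note wG = below_carrier[OF w]
  have iw: "inv\<^bsub>Fn\<^esub> w \<in> gens_below m"
    using w subgroup_gens_below[of m] m by (auto intro: subgroup.m_inv_closed)
  have one: "partial_conj m \<one>\<^bsub>Fn\<^esub> x = x" if "x \<in> carrier Fn" for x
  proof -
    have "partial_conj m \<one>\<^bsub>Fn\<^esub> x = id x"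
    proof (rule hom_eq_on_generate[OF F.group_axioms F.group_axioms partial_conj_hom[OF F.one_closed]])
      show "x \<in> generate Fn (gen ` {1..n})" using that generate_gen by simp
      show "gen ` {1..n} \<subseteq> carrier Fn" using gen_in_carrier by blast
      show "id \<in> hom Fn Fn" by (simp add: hom_def)
    qed (use partial_conj_gen[OF F.one_closed] gen_in_carrier in \<open>auto simp: conj_by_one\<close>)
    then show ?thesis by simp
  qed
  show "partial_conj m (inv\<^bsub>Fn\<^esub> w) \<in> carrier Fn \<rightarrow> carrier Fn"
    using wG by (auto intro: partial_conj_closed)
  fix x assume x: "x \<in> carrier Fn"
  show "partial_conj m (inv\<^bsub>Fn\<^esub> w) (partial_conj m w x) = x"
    "partial_conj m w (partial_conj m (inv\<^bsub>Fn\<^esub> w) x) = x"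
    using partial_conj_partial_conj[OF iw w x] partial_conj_partial_conj[OF w iw x] one[OF x] wG by simp_all
qed (use partial_conj_hom partial_conj_ext below_carrier[OF w] in auto)

lemma partial_conj_Tri:
  assumes w: "w \<in> gens_below m"
  shows "partial_conj m w \<in> Tri"
proof (rule Tri_I[OF partial_conj_auto[OF w]])
  fix i assume i: "i \<in> {1..n}"
  show "\<exists>w'\<in>gens_below i. partial_conj m w (gen i) = conj_by Fn (gen i) w'"
  proof (cases "i = m")
    case True
    then show ?thesis using w partial_conj_gen[OF below_carrier[OF w] i] by auto
  next
    case False
    then show ?thesis
      using partial_conj_gen[OF below_carrier[OF w] i] conj_by_one[OF gen_in_carrier[OF i]]
        generate.one[of Fn "gen ` {1..<i}"] by metis
  qed
qed

text \<open>\<open>F\<^sub>m\<^sub>-\<^sub>1\<close> is a retract of \<open>F\<^sub>n\<close>, so the restriction of the lower central series of \<open>F\<^sub>n\<close> to it is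
  its own, and is mapped into that of \<open>K\<close>.\<close>

lemma partial_conj_lower_central:
  assumes w: "w \<in> gens_below m" and j: "w \<in> lower_central Fn j"
  shows "partial_conj m w \<in> lower_central KG j"
proof -
  \<comment> \<open>The retraction onto the subgroup generated by x_1, ..., x_(m-1), which sends the
    remaining generators to 1.\<close>
  define r where "r = endo (\<lambda>i. if i < m then gen i else \<one>\<^bsub>Fn\<^esub>)"
  have "(if i < m then gen i else \<one>\<^bsub>Fn\<^esub>) \<in> carrier Fn" if "i \<in> {1..n}" for i
    using gen_in_carrier[OF that] by simp
  note e = endo[of "\<lambda>i. if i < m then gen i else \<one>\<^bsub>Fn\<^esub>", OF this, folded r_def]
  have e1: "r \<in> hom Fn Fn" and e3: "\<And>i. i \<in> {1..n} \<Longrightarrow> r (gen i) = (if i < m then gen i else \<one>\<^bsub>Fn\<^esub>)"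
    using e by blast+
  interpret r: group_hom Fn Fn r
    using e1 by (simp add: group_hom_def group_hom_axioms_def F.group_axioms)
  have sg: "subgroup (gens_below m) Fn" using subgroup_gens_below[of m] m by simp
  have gens: "gen ` {1..n} \<subseteq> carrier Fn" using gen_in_carrier by blast
  have "r ` gen ` {1..n} \<subseteq> gens_below m"
  proof (clarify)
    fix i assume i: "i \<in> {1..n}"
    show "r (gen i) \<in> gens_below m"
      using e3[OF i] i gen_in_gens_below[of i m] generate.one[of Fn "gen ` {1..<m}"] by simp
  qed
  then have "generate Fn (r ` gen ` {1..n}) \<subseteq> gens_below m"
    by (rule F.generate_subgroup_incl[OF _ sg])
  then have r: "r x \<in> gens_below m" if "x \<in> carrier Fn" for x
    using that r.generate_img[OF gens] generate_gen[of n] by blast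
  have rw: "r w = w"
  proof -
    have "r w = id w"
    proof (rule hom_eq_on_generate[OF F.group_axioms F.group_axioms e1 _ _ _ w])
      show "id \<in> hom Fn Fn" by (simp add: hom_def)
      show "gen ` {1..<m} \<subseteq> carrier Fn" using gens_below_carrier[of m] m by simp
      fix s assume "s \<in> gen ` {1..<m}"
      then show "r s = id s" using e3 m by auto
    qed
    then show ?thesis by simp
  qed
  \<comment> \<open>Precomposing with \<open>r\<close> gives a homomorphism on all of F_n, where
    \<open>w\<close> is known to lie in Gamma_j; and \<open>r\<close> fixes
    \<open>w\<close>.\<close>
  have "(\<lambda>w. partial_conj m (r w)) \<in> hom Fn Aut"
  proof (rule homI)
    fix x y assume xy: "x \<in> carrier Fn" "y \<in> carrier Fn"
    note rx = r[OF xy(1)] and ry = r[OF xy(2)]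
    have rxy: "r x \<otimes>\<^bsub>Fn\<^esub> r y \<in> gens_below m" by (rule subgroup.m_closed[OF sg rx ry])
    have "partial_conj m (r x \<otimes>\<^bsub>Fn\<^esub> r y) = partial_conj m (r x) \<otimes>\<^bsub>Aut\<^esub> partial_conj m (r y)"
    proof (rule auto_eqI[OF partial_conj_auto[OF rxy] Aut_closed(1)[OF partial_conj_auto[OF rx] partial_conj_auto[OF ry]]])
      fix i assume "i \<in> {1..n}"
      then show "partial_conj m (r x \<otimes>\<^bsub>Fn\<^esub> r y) (gen i) = (partial_conj m (r x) \<otimes>\<^bsub>Aut\<^esub> partial_conj m (r y)) (gen i)"
        using partial_conj_partial_conj[OF rx ry gen_in_carrier]
          Aut_mult_apply[OF partial_conj_auto[OF rx] partial_conj_auto[OF ry] gen_in_carrier] by simp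
    qed
    then show "partial_conj m (r (x \<otimes>\<^bsub>Fn\<^esub> y)) = partial_conj m (r x) \<otimes>\<^bsub>Aut\<^esub> partial_conj m (r y)"
      using xy by simp
  qed (use partial_conj_auto[OF r] in simp)
  then have "(\<lambda>w. partial_conj m (r w)) \<in> hom Fn KG"
    using Tri_in_K[OF partial_conj_Tri[OF r]] by (intro hom_into_KG) auto
  from hom_lower_central[OF F.group_axioms group_KG this j] show ?thesis by (simp only: rw)
qed

end

section \<open>From the filtration back to the lower central series\<close>

lemma Tri_lower_central:
  assumes \<psi>: "\<psi> \<in> auto Fn" and w: "\<And>i. i \<in> {1..n} \<Longrightarrow> w i \<in> gens_below i"
    "\<And>i. i \<in> {1..n} \<Longrightarrow> w i \<in> lower_central Fn j"
    "\<And>i. i \<in> {1..n} \<Longrightarrow> \<psi> (gen i) = conj_by Fn (gen i) (w i)"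
  shows "\<psi> \<in> lower_central KG j"
proof -
  interpret KG: group KG by (rule group_KG)
  have sub: "lower_central KG j \<subseteq> auto Fn"
    using KG.lower_central_sub_carrier K_subset_IA IA_subset_auto by auto
  \<comment> \<open>\<open>P\<close> is the product of the single-generator conjugations for 1, ...,
    k, the later ones composed on the left; for \<open>k = n\<close> it is
    \<open>\<psi>\<close>.\<close>
  have "\<exists>P\<in>lower_central KG j. \<forall>i\<in>{1..n}. P (gen i) = (if i \<le> k then \<psi> (gen i) else gen i)"
    if "k \<le> n" for k
    using that
  proof (induction k)
    case 0
    have "\<one>\<^bsub>KG\<^esub> \<in> lower_central KG j" by (rule subgroup.one_closed[OF KG.lower_central_subgroup])
    moreover have "\<one>\<^bsub>KG\<^esub> = \<one>\<^bsub>Aut\<^esub>" by (simp add: KG_eq)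
    ultimately show ?case
      using Aut_one_apply gen_in_carrier by (intro bexI[of _ "\<one>\<^bsub>Aut\<^esub>"]) auto
  next
    case (Suc k)
    then obtain P where P: "P \<in> lower_central KG j"
      "\<And>i. i \<in> {1..n} \<Longrightarrow> P (gen i) = (if i \<le> k then \<psi> (gen i) else gen i)" by auto
    have k: "Suc k \<in> {1..n}" using Suc.prems by simp
    let ?c = "partial_conj (Suc k) (w (Suc k))"
    note wG = below_carrier[OF k w(1)[OF k]]
    have c: "?c \<in> lower_central KG j" using partial_conj_lower_central[OF k w(1,2)[OF k]] .
    have "?c \<otimes>\<^bsub>Aut\<^esub> P \<in> lower_central KG j"
      using subgroup.m_closed[OF KG.lower_central_subgroup c P(1)] by (simp add: KG_eq)
    moreover have "(?c \<otimes>\<^bsub>Aut\<^esub> P) (gen i) = (if i \<le> Suc k then \<psi> (gen i) else gen i)"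
      if i: "i \<in> {1..n}" for i
    proof -
      have "(?c \<otimes>\<^bsub>Aut\<^esub> P) (gen i) = ?c (P (gen i))"
        using c P(1) sub by (intro Aut_mult_apply gen_in_carrier[OF i]) auto
      \<comment> \<open>The images already correct are words in x_1, ..., x_k, which the new factor
        fixes.\<close>
      moreover have "?c (\<psi> (gen i)) = \<psi> (gen i)" if "i \<le> k"
      proof (rule partial_conj_fixes[OF k wG])
        have "w i \<in> gens_below (Suc k)" using w(1)[OF i] gens_below_mono[of i "Suc k"] that by auto
        then show "\<psi> (gen i) \<in> gens_below (Suc k)"
          using w(3)[OF i] i that gen_in_gens_below[of i "Suc k"] subgroup_gens_below[of "Suc k"] Suc.prems
          by (simp add: conj_by_in_subgroup)
      qed
      moreover have "?c (gen i) = (if i = Suc k then \<psi> (gen i) else gen i)"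
        using partial_conj_gen[OF k wG i] w(3)[OF i] by auto
      ultimately show ?thesis using P(2)[OF i] by auto
    qed
    ultimately show ?case by blast
  qed
  then obtain P where P: "P \<in> lower_central KG j" "\<And>i. i \<in> {1..n} \<Longrightarrow> P (gen i) = \<psi> (gen i)"
    by force
  have "P = \<psi>" using P sub by (intro auto_eqI \<psi>) auto
  then show ?thesis using P(1) by simp
qed

text \<open>The displacement of x_i is the commutator of w^-1 with x_i; as x_i lies in Gamma_1, the
  filtration puts it into Gamma_(j+1).\<close>

lemma conj_by_filt:
  assumes "\<phi> \<in> filt j" "i \<in> {1..n}" "w \<in> carrier Fn" "\<phi> (gen i) = conj_by Fn (gen i) w"
  shows "F.commutator (inv\<^bsub>Fn\<^esub> w) (gen i) \<in> lower_central Fn (Suc j)"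
  using filt_D[OF assms(1), of 1 "gen i"] assms gen_in_carrier[OF assms(2)]
  by (simp add: conj_by_displacement)

lemma lower_central_inv_iff:
  "w \<in> carrier Fn \<Longrightarrow> inv\<^bsub>Fn\<^esub> w \<in> lower_central Fn j \<Longrightarrow> w \<in> lower_central Fn j"
  using subgroup.m_inv_closed[OF F.lower_central_subgroup, of "inv\<^bsub>Fn\<^esub> w" j] by simp

text \<open>The conjugation by \<open>x\<^sub>1\<^sup>k\<close> that \<open>\<psi>\<close> induces on \<open>x\<^sub>2\<close> can be moved into the inner factor.\<close>

lemma K_decomposition:
  assumes \<phi>: "\<phi> \<in> K" and n: "n \<ge> 1"
  obtains w \<psi> where "w \<in> carrier Fn" "\<psi> \<in> Tri" "\<phi> = inner w \<otimes>\<^bsub>Aut\<^esub> \<psi>" "\<psi> (gen 1) = gen 1"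
    "n \<ge> 2 \<Longrightarrow> \<psi> (gen 2) = gen 2"
proof -
  obtain u \<psi> where u: "u \<in> carrier Fn" and \<psi>: "\<psi> \<in> Tri" and eq: "\<phi> = inner u \<otimes>\<^bsub>Aut\<^esub> \<psi>"
    using K_E[OF \<phi>] .
  obtain w where w: "\<And>i. i \<in> {1..n} \<Longrightarrow> w i \<in> gens_below i" "\<And>i. i \<in> {1..n} \<Longrightarrow> w i \<in> carrier Fn"
    "\<And>i. i \<in> {1..n} \<Longrightarrow> \<psi> (gen i) = conj_by Fn (gen i) (w i)"
    using Tri_E[OF \<psi>] by metis
  note \<psi>a = Tri_auto[OF \<psi>]
  have 1: "1 \<in> {1..n}" using n by simp
  have w1: "w 1 = \<one>\<^bsub>Fn\<^esub>" using w(1)[OF 1] by (simp add: F.generate_empty)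
  show thesis
  proof (cases "n \<ge> 2")
    case False
    then show thesis
      using that[OF u \<psi> eq] w(3)[OF 1] w1 conj_by_one[OF gen_in_carrier[OF 1]] by simp
  next
    case True
    then have 2: "2 \<in> {1..n}" by simp
    define y where "y = w 2"
    have y2: "y \<in> gens_below 2" and yG: "y \<in> carrier Fn" using w(1,2)[OF 2] by (simp_all add: y_def)
    \<comment> \<open>The conjugator of x_2 lies in the cyclic subgroup generated by x_1, so it
      commutes with x_1.\<close>
    have "F.commutator y (gen 1) \<in> {\<one>\<^bsub>Fn\<^esub>}"
    proof (rule F.generate_commutator_mem[OF F.one_is_normal _ gen_in_carrier[OF 1] _ y2])
      show "gen ` {1..<2} \<subseteq> carrier Fn" using gens_below_carrier[of 2] True by simp
      fix s assume "s \<in> gen ` {1..<(2::nat)}"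
      then have "s = gen 1" by (auto simp: less_2_cases_iff)
      then show "F.commutator s (gen 1) \<in> {\<one>\<^bsub>Fn\<^esub>}" using F.commutator_self[OF gen_in_carrier[OF 1]] by simp
    qed
    then have c1: "conj_by Fn (gen 1) (inv\<^bsub>Fn\<^esub> y) = gen 1"
      using conj_by_displacement[OF gen_in_carrier[OF 1], of "inv\<^bsub>Fn\<^esub> y"] yG gen_in_carrier[OF 1]
        F.inv_solve_right'[of "conj_by Fn (gen 1) (inv\<^bsub>Fn\<^esub> y)"]
      by (metis F.inv_closed F.inv_equality F.inv_inv conj_by_closed singletonD)
    \<comment> \<open>Following \<open>\<psi>\<close> by conjugation with y^-1 undoes its effect on
      x_2 and still fixes x_1.\<close>
    define \<chi> where "\<chi> = inner (inv\<^bsub>Fn\<^esub> y) \<otimes>\<^bsub>Aut\<^esub> \<psi>"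
    have \<chi>a: "\<chi> \<in> auto Fn" unfolding \<chi>_def using yG \<psi>a by (intro Aut_closed inner_auto) auto
    have \<chi>: "\<chi> (gen i) = conj_by Fn (gen i) (w i \<otimes>\<^bsub>Fn\<^esub> inv\<^bsub>Fn\<^esub> y)" if i: "i \<in> {1..n}" for i
      unfolding \<chi>_def using yG \<psi>a gen_in_carrier[OF i] w(2,3)[OF i]
      by (simp add: Aut_mult_apply inner_auto inner_apply conj_by_closed conj_by_conj_by)
    have \<chi>1: "\<chi> (gen 1) = gen 1" using \<chi>[OF 1] w1 c1 yG by simp
    have \<chi>2: "\<chi> (gen 2) = gen 2"
      using \<chi>[OF 2] yG conj_by_one[OF gen_in_carrier[OF 2]] by (simp add: y_def)
    have "\<chi> \<in> Tri"
    proof (rule Tri_I[OF \<chi>a])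
      fix i assume i: "i \<in> {1..n}"
      show "\<exists>w\<in>gens_below i. \<chi> (gen i) = conj_by Fn (gen i) w"
      \<comment> \<open>The element y^-1 need not lie in the trivial subgroup allowed for x_1, so
        this case uses that x_1 is fixed.\<close>
      proof (cases "i = 1")
        case True
        then show ?thesis
          using \<chi>1 conj_by_one[OF gen_in_carrier[OF 1]] generate.one[of Fn "gen ` {1..<i}"] by metis
      next
        case False
        then have sg: "subgroup (gens_below i) Fn" and "y \<in> gens_below i"
          using subgroup_gens_below[of i] i y2 gens_below_mono[of 2 i] by auto
        then have "w i \<otimes>\<^bsub>Fn\<^esub> inv\<^bsub>Fn\<^esub> y \<in> gens_below i"
          using w(1)[OF i] by (intro subgroup.m_closed[OF sg] subgroup.m_inv_closed[OF sg])
        then show ?thesis using \<chi>[OF i] by blast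
      qed
    qed
    moreover have "\<phi> = inner (y \<otimes>\<^bsub>Fn\<^esub> u) \<otimes>\<^bsub>Aut\<^esub> \<chi>"
    proof -
      have "inner y \<otimes>\<^bsub>Aut\<^esub> inner (inv\<^bsub>Fn\<^esub> y) = \<one>\<^bsub>Aut\<^esub>"
        using yG by (simp add: inner_mult inner_one)
      then have "inner y \<otimes>\<^bsub>Aut\<^esub> \<chi> = \<psi>"
        unfolding \<chi>_def using A.m_assoc[of "inner y" "inner (inv\<^bsub>Fn\<^esub> y)" \<psi>] yG \<psi>a A.l_one[of \<psi>]
        by (simp add: inner_auto)
      then show ?thesis
        using eq A.m_assoc[of "inner u" "inner y" \<chi>] u yG \<chi>a inner_mult[of u y]
        by (simp add: inner_auto)
    qed
    ultimately show thesis using that[of "y \<otimes>\<^bsub>Fn\<^esub> u" \<chi>] u yG \<chi>1 \<chi>2 by simp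
  qed
qed

lemma filt_subset_lower_central_K:
  assumes n: "n \<ge> 1" and j: "j \<ge> 1"
  shows "K \<inter> filt j \<subseteq> lower_central KG j"
proof
  fix \<phi> assume "\<phi> \<in> K \<inter> filt j"
  then have \<phi>: "\<phi> \<in> K" "\<phi> \<in> filt j" by auto
  interpret KG: group KG by (rule group_KG)
  note sgL = KG.lower_central_subgroup
  obtain u \<psi> where u: "u \<in> carrier Fn" and \<psi>: "\<psi> \<in> Tri" and eq: "\<phi> = inner u \<otimes>\<^bsub>Aut\<^esub> \<psi>"
    and \<psi>1: "\<psi> (gen 1) = gen 1" and \<psi>2: "n \<ge> 2 \<Longrightarrow> \<psi> (gen 2) = gen 2"
    using K_decomposition[OF \<phi>(1) n] by blast
  note \<psi>a = Tri_auto[OF \<psi>]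
  have \<phi>i: "\<phi> (gen i) = conj_by Fn (gen i) u" if "i \<in> {1..n}" "\<psi> (gen i) = gen i" for i
    unfolding eq using that u \<psi>a gen_in_carrier by (simp add: Aut_mult_apply inner_auto inner_apply)
  have 1: "1 \<in> {1..n}" using n by simp
  \<comment> \<open>On x_1 and x_2 the automorphism is conjugation by \<open>u\<close> alone, so
    u^-1 commutes with both modulo Gamma_(j+1).\<close>
  have inner: "inner u \<in> lower_central KG j"
  proof (cases "n \<ge> 2")
    case True
    then have 2: "2 \<in> {1..n} - {1}" by simp
    have "inv\<^bsub>Fn\<^esub> u \<in> lower_central Fn j"
    proof (rule lower_central_if_commutes[OF _ 1])
      show "F.commutator (inv\<^bsub>Fn\<^esub> u) (gen 1) \<in> lower_central Fn (Suc j)"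
        using conj_by_filt[OF \<phi>(2) 1 u \<phi>i[OF 1 \<psi>1]] .
      have "F.commutator (inv\<^bsub>Fn\<^esub> u) (gen 2) \<in> lower_central Fn (Suc j)"
        using conj_by_filt[OF \<phi>(2) _ u \<phi>i[OF _ \<psi>2[OF True]]] 2 by blast
      then show "inv\<^bsub>Fn\<^esub> u \<in> generate Fn (gen ` ({1..n} - {1})) \<or>
          (\<exists>l\<in>{1..n} - {1}. F.commutator (inv\<^bsub>Fn\<^esub> u) (gen l) \<in> lower_central Fn (Suc j))"
        using 2 by blast
    qed (use u in simp)
    then show ?thesis using inner_lower_central lower_central_inv_iff[OF u] by blast
  next
    case False
    \<comment> \<open>In rank one there is no second generator and \<open>u\<close> need not lie in
      Gamma_j; but the group is abelian, so the inner factor is trivial.\<close>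
    then have n1: "{1..n} = {1}" using n by auto
    have "F.commutator u (gen 1) \<in> {\<one>\<^bsub>Fn\<^esub>}"
    proof (rule F.generate_commutator_mem[OF F.one_is_normal _ gen_in_carrier[OF 1]])
      show "gen ` {1..n} \<subseteq> carrier Fn" using gen_in_carrier by blast
      show "u \<in> generate Fn (gen ` {1..n})" using u generate_gen by simp
      fix s assume "s \<in> gen ` {1..n}"
      then have "s = gen 1" unfolding n1 by simp
      then show "F.commutator s (gen 1) \<in> {\<one>\<^bsub>Fn\<^esub>}" using F.commutator_self[OF gen_in_carrier[OF 1]] by simp
    qed
    then have "gen 1 \<otimes>\<^bsub>Fn\<^esub> u = u \<otimes>\<^bsub>Fn\<^esub> gen 1"
      using F.commutator_mult_swap[OF u gen_in_carrier[OF 1]] u gen_in_carrier[OF 1] by simp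
    then have c: "conj_by Fn (gen 1) u = gen 1"
      using u gen_in_carrier[OF 1] by (simp add: conj_by_def F.m_assoc F.cancel_inv_left)
    have "inner u = \<one>\<^bsub>Aut\<^esub>"
    proof (rule auto_eqI[OF inner_auto[OF u] Aut_closed(3)])
      fix i assume "i \<in> {1..n}"
      then have "i = 1" unfolding n1 by simp
      then show "inner u (gen i) = \<one>\<^bsub>Aut\<^esub> (gen i)"
        using c gen_in_carrier[OF 1] by (simp add: inner_apply Aut_one_apply)
    qed
    then show ?thesis using subgroup.one_closed[OF sgL] by (simp add: KG_eq)
  qed
  \<comment> \<open>The easy inclusions return the inner factor to the filtration, so it can be
    stripped off.\<close>
  have "inner u \<in> filt j"
    using inner lower_central_KG_subset lower_central_IA_subset_filt[OF j] by blast
  then have "inv\<^bsub>Aut\<^esub> (inner u) \<otimes>\<^bsub>Aut\<^esub> \<phi> \<in> filt j"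
    using \<phi>(2) by (intro subgroup.m_closed[OF subgroup_filt] subgroup.m_inv_closed[OF subgroup_filt])
  moreover have "inv\<^bsub>Aut\<^esub> (inner u) \<otimes>\<^bsub>Aut\<^esub> \<phi> = \<psi>"
    unfolding eq using A.cancel_inv_left[of "inner u" \<psi>] inner_auto[OF u] \<psi>a by simp
  ultimately have \<psi>f: "\<psi> \<in> filt j" by simp
  obtain w where w: "\<And>i. i \<in> {1..n} \<Longrightarrow> w i \<in> gens_below i" "\<And>i. i \<in> {1..n} \<Longrightarrow> w i \<in> carrier Fn"
    "\<And>i. i \<in> {1..n} \<Longrightarrow> \<psi> (gen i) = conj_by Fn (gen i) (w i)"
    using Tri_E[OF \<psi>] by metis
  have "w i \<in> lower_central Fn j" if i: "i \<in> {1..n}" for i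
  proof (rule lower_central_inv_iff[OF w(2)[OF i] lower_central_if_commutes[OF _ i]])
    show "F.commutator (inv\<^bsub>Fn\<^esub> (w i)) (gen i) \<in> lower_central Fn (Suc j)"
      using conj_by_filt[OF \<psi>f i w(2,3)[OF i]] .
    \<comment> \<open>Triangularity supplies the first alternative of the centralizer lemma: the
      conjugator of x_i does not involve x_i.\<close>
    have "gens_below i \<subseteq> generate Fn (gen ` ({1..n} - {i}))"
      using i by (intro F.mono_generate image_mono) auto
    moreover have "inv\<^bsub>Fn\<^esub> (w i) \<in> gens_below i"
      using subgroup.m_inv_closed[OF subgroup_gens_below w(1)[OF i]] i by simp
    ultimately show "inv\<^bsub>Fn\<^esub> (w i) \<in> generate Fn (gen ` ({1..n} - {i})) \<or>
          (\<exists>l\<in>{1..n} - {i}. F.commutator (inv\<^bsub>Fn\<^esub> (w i)) (gen l) \<in> lower_central Fn (Suc j))"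
      by blast
  qed (use w(2)[OF i] in simp)
  then have "\<psi> \<in> lower_central KG j" using w by (intro Tri_lower_central[OF \<psi>a]) auto
  then have "inner u \<otimes>\<^bsub>KG\<^esub> \<psi> \<in> lower_central KG j" by (rule subgroup.m_closed[OF sgL inner])
  then show "\<phi> \<in> lower_central KG j" unfolding eq by (simp add: KG_eq)
qed

end

theorem theorem5p4:
  fixes n :: nat
  assumes "n \<ge> 1"
  shows "satisfies_andreadakis_equality n (partial_inner n)"
  unfolding satisfies_andreadakis_equality_def
proof (intro conjI allI impI subgroup_K)
  fix j :: nat
  assume j: "j \<ge> 1"
  let ?KG = "(IA_group n)\<lparr>carrier := partial_inner n\<rparr>"
  have "lower_central ?KG j \<subseteq> partial_inner n \<inter> lower_central (IA_group n) j"
    using lower_central_KG_subset group.lower_central_sub_carrier[OF group_KG, of n j] by auto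
  moreover have "partial_inner n \<inter> lower_central (IA_group n) j \<subseteq> partial_inner n \<inter> andreadakis_filtration n j"
    using lower_central_IA_subset_filt[OF j] by blast
  moreover note filt_subset_lower_central_K[OF assms j]
  ultimately show "lower_central ?KG j = partial_inner n \<inter> lower_central (IA_group n) j"
    "partial_inner n \<inter> lower_central (IA_group n) j = partial_inner n \<inter> andreadakis_filtration n j"
    by blast+
qed

end
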